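(* Let $(a_1,\dots,a_k)\in\mathcal{A}$, let $M_n=\max_{1\le i\le n}\frac{\phi_k(X_i)}{n}$, and fix any $\epsilon>0$. Then, either in the case of (i) $(a_1,\dots,a_{k-1})\in\mathcal{S}_2$, or (ii) $(a_1,\dots,a_{k-1})\in\mathcal{S}_1$ and $a_k\le g_2(a_1,\dots,a_{k-1})$, $$\limsup_{\delta\to0}\limsup_{n\to\infty}\frac1n\log\mathbb{P}(M_n\ge\epsilon\mid C_n^\delta)<0.$$ In particular, localization does not happen in the sense that $$\lim_{\delta\to0}\lim_{n\to\infty}\mathbb{P}(M_n<\epsilon\mid C_n^\delta)=1.$$ On the other hand, in the case of $(a_1,\dots,a_{k-1})\in\mathcal{S}_1$ and $a_k>g_2(a_1,\dots,a_{k-1})$, we have the upper tail estimate $$\limsup_{\delta\to0}\limsup_{n\to\infty}\frac1n\log\mathbb{P}\big(M_n\ge a_k-g_2(a_1,\dots,a_{k-1})+\epsilon\mid C_n^\delta\big)<0.$$ In particular, $$\limsup_{\delta\to0}\limsup_{n\to\infty}\mathbb{P}\big(M_n<a_k-g_2(a_1,\dots,a_{k-1})+\epsilon\mid C_n^\delta\big)=1.$$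
   Context: Fix an integer $k\ge2$ and functions $\phi_1,\dots,\phi_k:(0,\infty)\to(0,\infty)$ such that: (C1) each $\phi_i$ is $C^1$, increasing, and $\lim_{x\to\infty}\phi_i(x)=\infty$; (C2) for each $i$ and any $c>0$, $\int_0^\infty e^{-c\phi_i}dx<\infty$; (C3) there exists $\kappa>1$ such that for each $1\le i\le k-1$, $\phi_i(x)^\kappa<\phi_{i+1}(x)$ for all sufficiently large $x$; (C4) there exist $C,M>0$ such that $x>C$ implies $\frac1C\phi_i(x)^{-M}<\phi_i'(x)<C\phi_i(x)^M$ for each $i$. $\mathcal{M}_1((0,\infty))$ is the space of Borel probability measures on $(0,\infty)$ with the weak topology, and $\int$ means integration over $(0,\infty)$. Let $\lambda=\frac1Z e^{-\phi_1}dx$ be a probability measure on $(0,\infty)$. On $\Omega=(0,\infty)^{\mathbb{N}}$ with coordinate projections $X_i$, let $\mathbb{P}=\lambda^{\otimes\mathbb{N}}$. Put $S_n^i=\frac1n(\phi_i(X_1)+\dots+\phi_i(X_n))$ and $C_n^\delta=\bigcap_{i=1}^k\{|S_n^i-a_i|\le\delta\}$ for $\delta>0$. The differential entropy is $h(\mu)=-\int\frac{d\mu}{dx}\log\big(\frac{d\mu}{dx}\big)dx$ if $\mu\ll dx$ and $h(\mu)=-\infty$ otherwise. Let $\mathcal{A}_1$ be the interior of the set of $(v_1,\dots,v_{k-1})\in(0,\infty)^{k-1}$ for which there is $\mu\in\mathcal{M}_1((0,\infty))$ with $h(\mu)\ne-\infty$, $\int\phi_i\,d\mu=v_i$ for $1\le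 i\le k-1$, and $\int\phi_k\,d\mu<\infty$. For $(v_1,\dots,v_{k-1})\in\mathcal{A}_1$ let $g_1(v_1,\dots,v_{k-1})=\inf\{\int\phi_k\,d\mu : \mu\in\mathcal{M}_1((0,\infty)),\ h(\mu)\ne-\infty,\ \int\phi_i\,d\mu=v_i\ (1\le i\le k-1)\}$. It is assumed that $g_1:\mathcal{A}_1\to\mathbb{R}$ is continuous. The admissible set is $\mathcal{A}=\{(v_1,\dots,v_k): (v_1,\dots,v_{k-1})\in\mathcal{A}_1,\ v_k>g_1(v_1,\dots,v_{k-1})\}$. Let $H(p_1,\dots,p_k)=\log\int e^{p_1\phi_1+\dots+p_k\phi_k}d\lambda\in(-\infty,\infty]$ on $\mathbb{R}^k$, a convex function with subdifferential $\partial H$. Let $\pi_1(v_1,\dots,v_k)=(v_1,\dots,v_{k-1})$ and $\pi_2(v_1,\dots,v_k)=v_k$. $\mathcal{S}_1\subset\mathcal{A}_1$ is the set of $(v_1,\dots,v_{k-1})\in\mathcal{A}_1$ such that $(v_1,\dots,v_{k-1})\in\pi_1(\partial H(p_1,\dots,p_{k-1},0))$ for some $p_1,\dots,p_{k-1}\in\mathbb{R}$ (such $p$'s are then unique); for these $p$'s, $g_2(v_1,\dots,v_{k-1})=\inf\pi_2(\partial H(p_1,\dots,p_{k-1},0))$. Finally $\mathcal{S}_2=\mathcal{A}_1\setminus\mathcal{S}_1$. Convention: $\log 0=-\infty$. *)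

theory Defs
  imports "HOL-Probability.Probability"
begin

text \<open>
  Vectors in \<open>\<real>\<^sup>m\<close> are functions \<open>nat \<Rightarrow> real\<close> that are extensional on \<open>{1..m}\<close>, i.e. the points of
  \<^term>\<open>powertop_real {1..m}\<close>. This allows \<open>\<real>\<^sup>k\<close> and \<open>\<real>\<^bsup>k-1\<^esup>\<close> to occur together. A function
  \<open>\<phi>\<^sub>i\<close> on \<open>(0,\<infinity>)\<close> is \<open>phi i :: real \<Rightarrow> real\<close>; only its values on \<^term>\<open>{0::real<..}\<close> matter.
\<close>

definition pos_lborel :: "real measure" where
  "pos_lborel = restrict_space lborel {0<..}"

definition pos_prob_measures :: "real measure set" where
  "pos_prob_measures = {mu. prob_space mu \<and> sets mu = sets pos_lborel}"

text \<open>
  The integral of \<open>- f ln f\<close> is the difference of the integrals of its positive and negative parts,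
  with value in \<open>[-\<infinity>,\<infinity>]\<close>; \<open>ennreal\<close> truncates negative arguments to \<open>0\<close>. Both parts can be infinite
  only if \<open>\<integral> \<phi>\<^sub>1 d\<mu> = \<infinity>\<close> (compare \<open>\<mu>\<close> with \<open>e\<^bsup>-\<phi>\<^sub>1\<^esup> dx\<close>), and below the entropy
  is only used for measures with \<open>\<integral> \<phi>\<^sub>1 d\<mu> < \<infinity>\<close>.
\<close>

definition diff_entropy :: "real measure \<Rightarrow> ereal" where
  "diff_entropy mu =
     (if absolutely_continuous pos_lborel mu then
        let f = (\<lambda>x. enn2real (RN_deriv pos_lborel mu x)) in
          enn2ereal (\<integral>\<^sup>+ x. ennreal (- (f x * ln (f x))) \<partial>pos_lborel)
          - enn2ereal (\<integral>\<^sup>+ x. ennreal (f x * ln (f x)) \<partial>pos_lborel)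
      else - \<infinity>)"

text \<open>The logarithm \<open>[0,\<infinity>] \<rightarrow> [-\<infinity>,\<infinity>]\<close>.\<close>

definition elog :: "ennreal \<Rightarrow> ereal" where
  "elog x = (if x = 0 then - \<infinity> else if x = \<infinity> then \<infinity> else ereal (ln (enn2real x)))"

definition lambda_measure :: "(nat \<Rightarrow> real \<Rightarrow> real) \<Rightarrow> real measure" where
  "lambda_measure phi =
     (let Z = (\<integral>x. exp (- phi 1 x) \<partial>pos_lborel)
      in density pos_lborel (\<lambda>x. ennreal (1 / Z * exp (- phi 1 x))))"

text \<open>The coordinate \<open>X\<^sub>j\<close> (\<open>j \<ge> 1\<close>) is \<open>\<omega> \<mapsto> \<omega> (j - 1)\<close>.\<close>

definition sample_measure :: "(nat \<Rightarrow> real \<Rightarrow> real) \<Rightarrow> (nat \<Rightarrow> real) measure" where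
  "sample_measure phi = PiM UNIV (\<lambda>_. lambda_measure phi)"

definition emp_mean :: "(nat \<Rightarrow> real \<Rightarrow> real) \<Rightarrow> nat \<Rightarrow> nat \<Rightarrow> (nat \<Rightarrow> real) \<Rightarrow> real" where
  "emp_mean phi n i \<omega> = (\<Sum>j<n. phi i (\<omega> j)) / real n"

definition constraint_event ::
    "nat \<Rightarrow> (nat \<Rightarrow> real \<Rightarrow> real) \<Rightarrow> (nat \<Rightarrow> real) \<Rightarrow> nat \<Rightarrow> real \<Rightarrow> (nat \<Rightarrow> real) \<Rightarrow> bool" where
  "constraint_event k phi a n \<delta> \<omega> \<longleftrightarrow> (\<forall>i\<in>{1..k}. \<bar>emp_mean phi n i \<omega> - a i\<bar> \<le> \<delta>)"

definition max_term :: "nat \<Rightarrow> (nat \<Rightarrow> real \<Rightarrow> real) \<Rightarrow> nat \<Rightarrow> (nat \<Rightarrow> real) \<Rightarrow> real" where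
  "max_term k phi n \<omega> = (MAX j\<in>{..<n}. phi k (\<omega> j) / real n)"

definition moment_measures ::
    "nat \<Rightarrow> (nat \<Rightarrow> real \<Rightarrow> real) \<Rightarrow> (nat \<Rightarrow> real) \<Rightarrow> real measure set" where
  "moment_measures k phi v =
     {mu \<in> pos_prob_measures. diff_entropy mu \<noteq> - \<infinity> \<and>
        (\<forall>i\<in>{1..k-1}. (\<integral>\<^sup>+ x. ennreal (phi i x) \<partial>mu) = ennreal (v i))}"

definition adm1 :: "nat \<Rightarrow> (nat \<Rightarrow> real \<Rightarrow> real) \<Rightarrow> (nat \<Rightarrow> real) set" where
  "adm1 k phi = powertop_real {1..k-1} interior_of
     {v \<in> {1..k-1} \<rightarrow>\<^sub>E {0<..}.
        \<exists>mu\<in>moment_measures k phi v. (\<integral>\<^sup>+ x. ennreal (phi k x) \<partial>mu) < \<infinity>}"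

text \<open>On \<^const>\<open>adm1\<close> the infimum is finite.\<close>

definition g1 :: "nat \<Rightarrow> (nat \<Rightarrow> real \<Rightarrow> real) \<Rightarrow> (nat \<Rightarrow> real) \<Rightarrow> real" where
  "g1 k phi v = enn2real (INF mu\<in>moment_measures k phi v. \<integral>\<^sup>+ x. ennreal (phi k x) \<partial>mu)"

definition adm :: "nat \<Rightarrow> (nat \<Rightarrow> real \<Rightarrow> real) \<Rightarrow> (nat \<Rightarrow> real) set" where
  "adm k phi = {v \<in> extensional {1..k}.
     restrict v {1..k-1} \<in> adm1 k phi \<and> v k > g1 k phi (restrict v {1..k-1})}"

definition log_mgf :: "nat \<Rightarrow> (nat \<Rightarrow> real \<Rightarrow> real) \<Rightarrow> (nat \<Rightarrow> real) \<Rightarrow> ereal" where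
  "log_mgf k phi p =
     elog (\<integral>\<^sup>+ x. ennreal (exp (\<Sum>i=1..k. p i * phi i x)) \<partial>lambda_measure phi)"

text \<open>
  If \<open>F p = \<infinity>\<close> and \<open>F\<close> is finite somewhere, the set below is empty, as usual.
\<close>

definition subdifferential ::
    "nat \<Rightarrow> ((nat \<Rightarrow> real) \<Rightarrow> ereal) \<Rightarrow> (nat \<Rightarrow> real) \<Rightarrow> (nat \<Rightarrow> real) set" where
  "subdifferential k F p = {w \<in> extensional {1..k}.
     \<forall>q\<in>extensional {1..k}. F q \<ge> F p + ereal (\<Sum>i=1..k. w i * (q i - p i))}"

text \<open>The parameter \<open>p\<close> stands for \<open>(p\<^sub>1, \<dots>, p\<^bsub>k-1\<^esub>, 0)\<close>.\<close>

definition dual_param ::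
    "nat \<Rightarrow> (nat \<Rightarrow> real \<Rightarrow> real) \<Rightarrow> (nat \<Rightarrow> real) \<Rightarrow> (nat \<Rightarrow> real) \<Rightarrow> bool" where
  "dual_param k phi v p \<longleftrightarrow> p \<in> extensional {1..k} \<and> p k = 0 \<and>
     v \<in> (\<lambda>w. restrict w {1..k-1}) ` subdifferential k (log_mgf k phi) p"

definition S1 :: "nat \<Rightarrow> (nat \<Rightarrow> real \<Rightarrow> real) \<Rightarrow> (nat \<Rightarrow> real) set" where
  "S1 k phi = {v \<in> adm1 k phi. \<exists>p. dual_param k phi v p}"

definition g2 :: "nat \<Rightarrow> (nat \<Rightarrow> real \<Rightarrow> real) \<Rightarrow> (nat \<Rightarrow> real) \<Rightarrow> real" where
  "g2 k phi v =
     Inf ((\<lambda>w. w k) ` subdifferential k (log_mgf k phi) (THE p. dual_param k phi v p))"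

definition S2 :: "nat \<Rightarrow> (nat \<Rightarrow> real \<Rightarrow> real) \<Rightarrow> (nat \<Rightarrow> real) set" where
  "S2 k phi = adm1 k phi - S1 k phi"

text \<open>
  \<open>limsup\<^bsub>\<delta>\<rightarrow>0\<^esub> limsup\<^bsub>n\<rightarrow>\<infinity>\<^esub> 1/n log P(M\<^sub>n \<ge> t | C\<^sub>n\<^sup>\<delta>)\<close>
\<close>

definition upper_tail_rate ::
    "nat \<Rightarrow> (nat \<Rightarrow> real \<Rightarrow> real) \<Rightarrow> (nat \<Rightarrow> real) \<Rightarrow> real \<Rightarrow> ereal" where
  "upper_tail_rate k phi a t =
     Limsup (at_right 0) (\<lambda>\<delta>. limsup (\<lambda>n. ereal (1 / real n) *
       elog (ennreal (\<P>(\<omega> in sample_measure phi.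
         max_term k phi n \<omega> \<ge> t \<bar> constraint_event k phi a n \<delta> \<omega>)))))"

definition lower_prob ::
    "nat \<Rightarrow> (nat \<Rightarrow> real \<Rightarrow> real) \<Rightarrow> (nat \<Rightarrow> real) \<Rightarrow> real \<Rightarrow> real \<Rightarrow> nat \<Rightarrow> real" where
  "lower_prob k phi a t \<delta> n =
     \<P>(\<omega> in sample_measure phi. max_term k phi n \<omega> < t \<bar> constraint_event k phi a n \<delta> \<omega>)"

end

theory Submission
  imports Defs "HOL-Real_Asymp.Real_Asymp"
begin

text \<open>
  Write \<open>H\<close> for the log moment generating function of \<open>(\<phi>\<^sub>1, \<dots>, \<phi>\<^sub>k)\<close> under \<open>\<lambda>\<close>, and let \<open>m\<close> be the infimum
  of the relative entropies \<open>\<integral> g ln g d\<lambda>\<close> over probability densities \<open>g\<close> with respect to \<open>\<lambda>\<close> whose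
  moments are \<open>a\<^sub>1, \<dots>, a\<^sub>k\<close>. Sampling from such a \<open>g\<close> instead of \<open>\<lambda>\<close> and the weak law of large numbers
  show that the conditioning event has probability at least \<open>e\<^bsup>-n(m+o(1))\<^esup>\<close> (\<open>entropy_lower_bound\<close>).

  Suppose now that some \<open>\<phi>\<^sub>k(X\<^sub>j)\<close> is at least \<open>n t\<close> while the constraints hold. The single value \<open>X\<^sub>j\<close>
  contributes only \<open>o(n)\<close> to the sums of the lower \<open>\<phi>\<^sub>i\<close>, because \<open>\<phi>\<^sub>i / \<phi>\<^sub>k \<rightarrow> 0\<close>. So the remaining
  terms have averages close to \<open>b = (a\<^sub>1, \<dots>, a\<^bsub>k-1\<^esub>, a\<^sub>k - t)\<close> in the first \<open>k - 1\<close> coordinates and at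
  most slightly above \<open>a\<^sub>k - t\<close> in the last one. For every \<open>q\<close> with \<open>H(q) < \<infinity>\<close> one has \<open>q\<^sub>k \<le> 0\<close>, and the
  exponential Markov inequality bounds the probability by \<open>e\<^bsup>-n(q\<cdot>b - H(q) - o(1))\<^esup>\<close>
  (\<open>large_term_probability_bound\<close>). The tail estimate therefore follows once some \<open>q\<close> satisfies
  \<open>q\<cdot>b - H(q) > m\<close>.

  Such a \<open>q\<close> is found by convex duality (\<open>strict_improvement\<close>). The moments and entropies that
  densities attain form a convex relation, and admissibility puts \<open>a\<close> into the interior of its domain
  (\<open>admissible_box\<close>). Hence there is a supporting slope \<open>p\<close> at \<open>a\<close>; testing it on truncated exponential
  tilts of \<open>\<lambda>\<close> gives \<open>H(p) \<le> p\<cdot>a - m\<close> (\<open>supporting_parameter\<close>). If no \<open>q\<close> improved on \<open>m\<close>, the choice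
  \<open>q = p\<close> would force \<open>p\<^sub>k = 0\<close>, and all other \<open>q\<close> together would say that \<open>b\<close> is a subgradient of \<open>H\<close> at
  \<open>p\<close>. Then \<open>(a\<^sub>1, \<dots>, a\<^bsub>k-1\<^esub>)\<close> lies in \<open>S\<^sub>1\<close> with parameter \<open>p\<close>, and \<open>g\<^sub>2 \<le> a\<^sub>k - t\<close>. This is impossible
  on \<open>S\<^sub>2\<close>, impossible for \<open>t = \<epsilon>\<close> if \<open>a\<^sub>k \<le> g\<^sub>2\<close>, and impossible for \<open>t = a\<^sub>k - g\<^sub>2 + \<epsilon>\<close>: these are the
  cases of the theorem.
\<close>

section \<open>Subgradients of convex relations\<close>

text \<open>
  This is the Hahn--Banach argument, written for a convex relation \<open>E v r\<close> that plays the role of the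
  epigraph of a convex function. The slope is chosen one coordinate at a time: the slopes towards
  points with smaller \<open>j\<close>-th coordinate stay below those towards points with larger one, since a segment
  joining two such points crosses the subspace already treated. The box around \<open>a\<close> makes both families
  nonempty. Vectors are functions on an arbitrary index type, so the dimension may vary.
\<close>

lemma convex_relation_subgradient:
  fixes E :: "('i \<Rightarrow> real) \<Rightarrow> real \<Rightarrow> bool"
  assumes fin: "finite I"
    and conv: "\<And>v w r s t. E v r \<Longrightarrow> E w s \<Longrightarrow> 0 \<le> t \<Longrightarrow> t \<le> 1 \<Longrightarrow>
                 E (\<lambda>i. (1 - t) * v i + t * w i) ((1 - t) * r + t * s)"
    and box: "\<rho> > 0" "\<And>v. (\<forall>i\<in>I. \<bar>v i - a i\<bar> < \<rho>) \<Longrightarrow> \<exists>r. E v r"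
    and lower: "\<And>v r. E v r \<Longrightarrow> (\<forall>i\<in>I. v i = a i) \<Longrightarrow> m \<le> r"
  shows "\<exists>p. \<forall>v r. E v r \<longrightarrow> m + (\<Sum>i\<in>I. p i * (v i - a i)) \<le> r"
proof -
  have "\<exists>p. \<forall>v r. E v r \<longrightarrow> (\<forall>i\<in>I - J. v i = a i) \<longrightarrow> m + (\<Sum>i\<in>J. p i * (v i - a i)) \<le> r"
    if "finite J" "J \<subseteq> I" for J
    using that
  proof (induction J rule: finite_induct)
    case empty
    then show ?case using lower by auto
  next
    case (insert j J)
    then obtain p where p: "\<And>v r. E v r \<Longrightarrow> (\<forall>i\<in>I - J. v i = a i) \<Longrightarrow>
        m + (\<Sum>i\<in>J. p i * (v i - a i)) \<le> r" by blast
    define N where "N v r \<longleftrightarrow> E v r \<and> (\<forall>i\<in>I - insert j J. v i = a i)" for v r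
    define L where "L v = m + (\<Sum>i\<in>J. p i * (v i - a i))" for v
    define D where "D = {(L v - r) / (a j - v j) | v r. N v r \<and> v j < a j}"
    have sep: "(L v - r) / (a j - v j) \<le> (s - L w) / (w j - a j)"
      if v: "N v r" "v j < a j" and w: "N w s" "a j < w j" for v r w s
    proof -
      define x where "x = a j - v j"
      define y where "y = w j - a j"
      have xy: "x > 0" "y > 0" using v w by (auto simp: x_def y_def)
      \<comment> \<open>The weight for which the \<open>j\<close>-th coordinate of the convex combination is \<open>a j\<close>.\<close>
      define t where "t = x / (x + y)"
      have t: "0 \<le> t" "t \<le> 1" using xy by (auto simp: t_def)
      have t1: "1 - t = y / (x + y)" using xy by (simp add: t_def field_simps)
      define u where "u i = (1 - t) * v i + t * w i" for i
      have "E u ((1 - t) * r + t * s)"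
        unfolding u_def using conv v w t by (auto simp: N_def)
      moreover have "u j = a j"
      proof -
        have "v j = a j - x" "w j = a j + y" by (auto simp: x_def y_def)
        hence "u j = (1 - t) * (a j - x) + t * (a j + y)" by (simp only: u_def)
        also have "\<dots> = a j - (1 - t) * x + t * y" by (simp add: algebra_simps)
        also have "(1 - t) * x = t * y" unfolding t1 by (simp add: t_def)
        finally show ?thesis by simp
      qed
      moreover have "u i = a i" if "i \<in> I - insert j J" for i
        using v w that by (simp add: u_def N_def algebra_simps)
      ultimately have "L u \<le> (1 - t) * r + t * s"
        unfolding L_def using p[of u] by auto
      moreover have "L u = (1 - t) * L v + t * L w"
      proof -
        have "u i - a i = (1 - t) * (v i - a i) + t * (w i - a i)" for i
          by (simp add: u_def algebra_simps)
        hence "(\<Sum>i\<in>J. p i * (u i - a i))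
             = (\<Sum>i\<in>J. (1 - t) * (p i * (v i - a i)) + t * (p i * (w i - a i)))"
          by (intro sum.cong refl) (simp only:, simp add: algebra_simps)
        also have "\<dots> = (1 - t) * (\<Sum>i\<in>J. p i * (v i - a i)) + t * (\<Sum>i\<in>J. p i * (w i - a i))"
          by (simp only: sum.distrib sum_distrib_left)
        finally show ?thesis unfolding L_def by (simp only:) (simp add: algebra_simps)
      qed
      ultimately have "(1 - t) * (L v - r) \<le> t * (s - L w)" by (simp add: algebra_simps)
      hence "(y * (L v - r)) / (x + y) \<le> (x * (s - L w)) / (x + y)"
        unfolding t1 by (simp add: t_def)
      hence "y * (L v - r) \<le> x * (s - L w)"
        using xy by (simp only: divide_le_cancel)
      thus ?thesis using xy unfolding x_def[symmetric] y_def[symmetric] by (simp add: field_simps)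
    qed
    have pt: "\<exists>r. N (a(j := a j + h)) r" if "\<bar>h\<bar> < \<rho>" for h
      using box(2)[of "a(j := a j + h)"] that box(1) by (auto simp: N_def)
    obtain r1 where r1: "N (a(j := a j + (- (\<rho> / 2)))) r1" using pt[of "- (\<rho>/2)"] box(1) by auto
    obtain r2 where r2: "N (a(j := a j + \<rho> / 2)) r2" using pt[of "\<rho>/2"] box(1) by auto
    have ne: "D \<noteq> {}"
      unfolding D_def using r1 box(1) by force
    have bdd: "bdd_above D"
      unfolding D_def by (rule bdd_aboveI) (use sep[OF _ _ r2] box(1) in auto)
    define c where "c = Sup D"
    have up: "c \<le> (s - L w) / (w j - a j)" if "N w s" "a j < w j" for w s
      unfolding c_def using ne by (rule cSup_least) (use sep that in \<open>auto simp: D_def\<close>)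
    have lo: "(L v - r) / (a j - v j) \<le> c" if "N v r" "v j < a j" for v r
      unfolding c_def using bdd by (intro cSup_upper) (use that in \<open>auto simp: D_def\<close>)
    have ext: "L v + c * (v j - a j) \<le> r" if "N v r" for v r
    proof (cases "v j" "a j" rule: linorder_cases)
      case less
      then show ?thesis using lo[OF that less] by (simp add: field_simps)
    next
      case equal
      then show ?thesis using p[of v r] that by (auto simp: N_def L_def)
    next
      case greater
      then show ?thesis using up[OF that greater] by (simp add: field_simps)
    qed
    have "(\<Sum>i\<in>insert j J. (p(j := c)) i * (v i - a i)) = c * (v j - a j) + (\<Sum>i\<in>J. p i * (v i - a i))" for v
    proof -
      have "(\<Sum>i\<in>J. (p(j := c)) i * (v i - a i)) = (\<Sum>i\<in>J. p i * (v i - a i))"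
        using insert.hyps by (intro sum.cong) auto
      thus ?thesis using insert.hyps by simp
    qed
    hence "m + (\<Sum>i\<in>insert j J. (p(j := c)) i * (v i - a i)) = L v + c * (v j - a j)" for v
      unfolding L_def by (simp only: add_ac)
    thus ?case
      using ext unfolding N_def by (intro exI[of _ "p(j := c)"] allI impI) (simp only:)
  qed
  from this[OF fin subset_refl] show ?thesis by simp
qed

section \<open>Averages of independent samples\<close>

lemma (in prob_space) product_prob_space_const: "product_prob_space (\<lambda>_. M)"
  by (simp add: product_prob_space_def product_prob_space_axioms_def product_sigma_finite_def
      prob_space_axioms sigma_finite_measure_axioms)

lemma (in prob_space) distr_PiM_coordinate:
  assumes "i \<in> I"
  shows "distr (PiM I (\<lambda>_. M)) M (\<lambda>x. x i) = M"
proof -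
  interpret P: product_prob_space "\<lambda>_. M" I by (rule product_prob_space_const)
  show ?thesis by (rule P.PiM_component[OF assms])
qed

lemma (in prob_space) integral_PiM_coordinate:
  fixes f :: "'a \<Rightarrow> real"
  assumes "i \<in> I" and [measurable]: "f \<in> borel_measurable M"
  shows "(\<integral>x. f (x i) \<partial>PiM I (\<lambda>_. M)) = (\<integral>x. f x \<partial>M)"
proof -
  have "(\<integral>x. f x \<partial>M) = (\<integral>x. f x \<partial>distr (PiM I (\<lambda>_. M)) M (\<lambda>x. x i))"
    using assms by (simp add: distr_PiM_coordinate)
  also have "\<dots> = (\<integral>x. f (x i) \<partial>PiM I (\<lambda>_. M))"
    using assms(1) by (intro integral_distr) simp_all
  finally show ?thesis ..
qed

lemma (in prob_space) integrable_PiM_coordinate: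
  fixes f :: "'a \<Rightarrow> real"
  assumes i: "i \<in> I" and f: "integrable M f"
  shows "integrable (PiM I (\<lambda>_. M)) (\<lambda>x. f (x i))"
proof -
  have "integrable (distr (PiM I (\<lambda>_. M)) M (\<lambda>x. x i)) f"
    using f by (simp add: distr_PiM_coordinate[OF i])
  thus ?thesis
    using i f by (subst (asm) integrable_distr_eq) (auto intro: borel_measurable_integrable)
qed

lemma (in prob_space) indep_vars_PiM_coordinates:
  assumes "I \<noteq> {}"
  shows "prob_space.indep_vars (PiM I (\<lambda>_. M)) (\<lambda>_. M) (\<lambda>i x. x i) I"
proof -
  interpret P: product_prob_space "\<lambda>_. M" I by (rule product_prob_space_const)
  have "distr (PiM I (\<lambda>_. M)) (PiM I (\<lambda>_. M)) (\<lambda>x. \<lambda>i\<in>I. x i)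
      = distr (PiM I (\<lambda>_. M)) (PiM I (\<lambda>_. M)) (\<lambda>x. x)"
    by (intro distr_cong) (auto simp: space_PiM)
  also have "\<dots> = PiM I (\<lambda>i. distr (PiM I (\<lambda>_. M)) M (\<lambda>x. x i))"
    by (simp add: distr_PiM_coordinate cong: PiM_cong)
  finally show ?thesis
    using assms by (subst P.indep_vars_iff_distr_eq_PiM') auto
qed

lemma borel_measurable_average:
  fixes f :: "'a \<Rightarrow> real"
  assumes "f \<in> borel_measurable M"
  shows "(\<lambda>x. (\<Sum>j<n. f (x j)) / real n) \<in> borel_measurable (PiM {..<n} (\<lambda>_. M))"
proof (intro borel_measurable_divide borel_measurable_sum)
  fix j assume "j \<in> {..<n}"
  thus "(\<lambda>x. f (x j)) \<in> borel_measurable (PiM {..<n} (\<lambda>_. M))"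
    using assms by (intro measurable_compose[OF measurable_component_singleton])
qed simp

lemma (in prob_space) bounded_average_deviation:
  fixes Y :: "'a \<Rightarrow> real" and L \<eta> :: real and n :: nat
  assumes [measurable]: "Y \<in> borel_measurable M"
    and bd: "\<And>x. x \<in> space M \<Longrightarrow> \<bar>Y x\<bar> \<le> L" and "L > 0" "n > 0" "\<eta> \<ge> 0"
  shows "measure (PiM {..<n} (\<lambda>_. M))
           {x\<in>space (PiM {..<n} (\<lambda>_. M)). \<bar>(\<Sum>j<n. Y (x j)) / real n - expectation Y\<bar> \<ge> \<eta>}
         \<le> 2 * exp (-2 * real n * \<eta>\<^sup>2 / (2 * L)\<^sup>2)"
proof -
  let ?P = "PiM {..<n} (\<lambda>_. M)"
  interpret P: product_prob_space "\<lambda>_. M" "{..<n}" by (rule product_prob_space_const)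
  have ind: "P.indep_vars (\<lambda>_. borel) (\<lambda>i x. Y (x i)) {..<n}"
    using P.indep_vars_compose2[OF indep_vars_PiM_coordinates, where Y = "\<lambda>_. Y" and N = "\<lambda>_. borel"]
      assms by (auto simp: lessThan_empty_iff)
  have dis: "distr ?P borel (\<lambda>x. Y (x i)) = distr M borel Y" if "i \<in> {..<n}" for i
  proof -
    have "distr M borel Y = distr (distr ?P M (\<lambda>x. x i)) borel Y"
      using that by (simp add: distr_PiM_coordinate)
    also have "\<dots> = distr ?P borel (\<lambda>x. Y (x i))"
      using that by (subst distr_distr) (auto simp: comp_def)
    finally show ?thesis ..
  qed
  have 0: "0 \<in> {..<n}" using \<open>n > 0\<close> by simp
  interpret H: Hoeffding_ineq_iid ?P "{..<n}" "\<lambda>i x. Y (x i)" "\<lambda>x. Y (x 0)" "-L" L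
    "P.expectation (\<lambda>x. Y (x 0))"
  proof unfold_locales
    show "AE x in ?P. Y (x 0) \<in> {-L..L}"
    proof (rule AE_I2)
      fix x assume "x \<in> space ?P"
      hence "x 0 \<in> space M" using 0 by (auto simp: space_PiM)
      from bd[OF this] show "Y (x 0) \<in> {-L..L}" by auto
    qed
    show "P.random_variable borel (\<lambda>x. Y (x 0))" using 0 by measurable
  qed (use ind dis 0 in auto)
  have "P.expectation (\<lambda>x. Y (x 0)) = expectation Y"
    using 0 by (intro integral_PiM_coordinate) auto
  moreover have "L - - L = 2 * L" by simp
  moreover have "- L < L" "{..<n} \<noteq> {}" using \<open>L > 0\<close> \<open>n > 0\<close> by (auto simp: lessThan_empty_iff)
  note H.Hoeffding_ineq_abs_ge'[OF \<open>\<eta> \<ge> 0\<close> this]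
  ultimately show ?thesis by (simp only: card_lessThan)
qed

text \<open>
  Only integrability of \<open>Y\<close> is available, because the densities of interest control first moments and
  entropy but no second moments. Truncation at a high level \<open>L\<close> reduces the claim to Hoeffding's
  inequality; the truncated remainder is small in \<open>L\<^sup>1\<close> and is handled by Markov's inequality.
\<close>

lemma (in prob_space) weak_law_of_large_numbers:
  fixes Y :: "'a \<Rightarrow> real" and \<eta> :: real
  assumes Y: "integrable M Y" and \<eta>: "\<eta> > 0"
  shows "(\<lambda>n. measure (PiM {..<n} (\<lambda>_. M))
            {x\<in>space (PiM {..<n} (\<lambda>_. M)). \<bar>(\<Sum>j<n. Y (x j)) / real n - expectation Y\<bar> \<ge> \<eta>})
         \<longlonglongrightarrow> 0"
proof (rule LIMSEQ_I)
  fix e :: real assume e: "e > 0"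
  have [measurable]: "Y \<in> borel_measurable M" using Y by simp
  define T where "T L x = (if \<bar>Y x\<bar> \<le> L then Y x else 0)" for L :: real and x
  have [measurable]: "T L \<in> borel_measurable M" for L unfolding T_def by measurable
  have T_int: "integrable M (T L)" for L
    by (rule Bochner_Integration.integrable_bound[OF Y]) (auto simp: T_def)
  have "(\<lambda>k. \<integral>x. \<bar>Y x - T (real k) x\<bar> \<partial>M) \<longlonglongrightarrow> (\<integral>x. 0 \<partial>M)"
  proof (rule integral_dominated_convergence[where w = "\<lambda>x. \<bar>Y x\<bar>"])
    show "AE x in M. (\<lambda>k. \<bar>Y x - T (real k) x\<bar>) \<longlonglongrightarrow> 0"
    proof (rule AE_I2, rule tendsto_eventually)
      fix x
      show "\<forall>\<^sub>F k in sequentially. \<bar>Y x - T (real k) x\<bar> = 0"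
        using eventually_ge_at_top[of "nat \<lceil>\<bar>Y x\<bar>\<rceil>"] by eventually_elim (auto simp: T_def nat_le_iff ceiling_le_iff)
    qed
  qed (use Y in \<open>auto simp: T_def\<close>)
  hence "(\<lambda>k. \<integral>x. \<bar>Y x - T (real k) x\<bar> \<partial>M) \<longlonglongrightarrow> 0" by simp
  from order_tendstoD(2)[OF this, of "min (\<eta> / 4) (\<eta> * e / 8)"]
  have "\<forall>\<^sub>F k in sequentially. (\<integral>x. \<bar>Y x - T (real k) x\<bar> \<partial>M) < min (\<eta> / 4) (\<eta> * e / 8)"
    using \<eta> e by simp
  from eventually_conj[OF this eventually_gt_at_top[of 0]] obtain k where k: "k > (0::nat)"
    and k1: "(\<integral>x. \<bar>Y x - T (real k) x\<bar> \<partial>M) < \<eta> / 4"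
    and k2: "(\<integral>x. \<bar>Y x - T (real k) x\<bar> \<partial>M) < \<eta> * e / 8"
    by (auto dest: eventually_happens)
  define L where "L = real k"
  define D where "D x = \<bar>Y x - T L x\<bar>" for x
  have D_int: "integrable M D" unfolding D_def using Y T_int by simp
  have D_meas [measurable]: "D \<in> borel_measurable M" using D_int by simp
  have L: "L > 0" and D1: "expectation D < \<eta> / 4" and D2: "expectation D < \<eta> * e / 8"
    using k k1 k2 by (auto simp: L_def D_def[abs_def])
  have mean: "\<bar>expectation Y - expectation (T L)\<bar> \<le> expectation D"
  proof -
    have "expectation Y - expectation (T L) = expectation (\<lambda>x. Y x - T L x)"
      using Y T_int by simp
    also have "\<bar>\<dots>\<bar> \<le> expectation D" unfolding D_def by (rule integral_abs_bound)
    finally show ?thesis .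
  qed
  have "(\<lambda>n. 2 * exp (-2 * real n * (\<eta>/2)\<^sup>2 / (2 * L)\<^sup>2)) \<longlonglongrightarrow> 0"
    using \<eta> L by real_asymp
  from order_tendstoD(2)[OF this, of "e/2"] e
  have ev: "\<forall>\<^sub>F n in sequentially. 2 * exp (-2 * real n * (\<eta>/2)\<^sup>2 / (2 * L)\<^sup>2) < e / 2" by simp
  have "\<forall>\<^sub>F n in sequentially. measure (PiM {..<n} (\<lambda>_. M))
            {x\<in>space (PiM {..<n} (\<lambda>_. M)). \<bar>(\<Sum>j<n. Y (x j)) / real n - expectation Y\<bar> \<ge> \<eta>} < e"
    using ev eventually_gt_at_top[of 0]
  proof eventually_elim
    case (elim n)
    let ?P = "PiM {..<n} (\<lambda>_. M)"
    interpret P: product_prob_space "\<lambda>_. M" "{..<n}" by (rule product_prob_space_const)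
    define A where "A = {x\<in>space ?P. \<bar>(\<Sum>j<n. T L (x j)) / real n - expectation (T L)\<bar> \<ge> \<eta> / 2}"
    define B where "B = {x\<in>space ?P. (\<Sum>j<n. D (x j)) / real n \<ge> \<eta> / 4}"
    have [measurable]: "A \<in> sets ?P" "B \<in> sets ?P" unfolding A_def B_def by measurable
    have "P.prob {x\<in>space ?P. \<bar>(\<Sum>j<n. Y (x j)) / real n - expectation Y\<bar> \<ge> \<eta>} \<le> P.prob (A \<union> B)"
    proof (rule P.finite_measure_mono)
      show "{x\<in>space ?P. \<bar>(\<Sum>j<n. Y (x j)) / real n - expectation Y\<bar> \<ge> \<eta>} \<subseteq> A \<union> B"
      proof (safe, rule ccontr)
        fix x assume x: "x \<in> space ?P" "\<bar>(\<Sum>j<n. Y (x j)) / real n - expectation Y\<bar> \<ge> \<eta>" "x \<notin> B" "x \<notin> A"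
        have "\<bar>(\<Sum>j<n. Y (x j)) / real n - (\<Sum>j<n. T L (x j)) / real n\<bar> = \<bar>\<Sum>j<n. Y (x j) - T L (x j)\<bar> / n"
          by (simp add: sum_subtractf diff_divide_distrib[symmetric])
        also have "\<dots> \<le> (\<Sum>j<n. D (x j)) / real n"
          unfolding D_def by (intro divide_right_mono sum_abs) auto
        finally have "\<bar>(\<Sum>j<n. Y (x j)) / real n - (\<Sum>j<n. T L (x j)) / real n\<bar> \<le> (\<Sum>j<n. D (x j)) / real n" .
        moreover have "(\<Sum>j<n. D (x j)) / real n < \<eta> / 4"
          using x unfolding B_def mem_Collect_eq by linarith
        moreover have "\<bar>(\<Sum>j<n. T L (x j)) / real n - expectation (T L)\<bar> < \<eta> / 2"
          using x unfolding A_def mem_Collect_eq by linarith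
        ultimately show False using x(2) mean D1 by linarith
      qed
    qed auto
    also have "\<dots> \<le> P.prob A + P.prob B" by (rule measure_Un_le) auto
    also have "P.prob A \<le> 2 * exp (-2 * real n * (\<eta>/2)\<^sup>2 / (2 * L)\<^sup>2)"
      unfolding A_def using elim L \<eta> by (intro bounded_average_deviation) (auto simp: T_def)
    also have "P.prob B \<le> e / 2"
    proof -
      have "P.prob B \<le> P.expectation (\<lambda>x. (\<Sum>j<n. D (x j)) / real n) / (\<eta> / 4)"
        unfolding B_def
      proof (rule integral_Markov_inequality_measure[where A = "{}"])
        show "integrable ?P (\<lambda>x. (\<Sum>j<n. D (x j)) / real n)"
          by (intro integrable_divide Bochner_Integration.integrable_sum integrable_PiM_coordinate D_int)
        show "AE x in ?P. 0 \<le> (\<Sum>j<n. D (x j)) / real n"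
          by (intro AE_I2 divide_nonneg_nonneg sum_nonneg) (auto simp: D_def)
      qed (use \<eta> in auto)
      also have "P.expectation (\<lambda>x. (\<Sum>j<n. D (x j)) / real n) = expectation D"
        using elim by (simp add: Bochner_Integration.integral_sum integrable_PiM_coordinate D_int
            integral_PiM_coordinate)
      also have "expectation D / (\<eta> / 4) \<le> (\<eta> * e / 8) / (\<eta> / 4)"
        using D2 \<eta> by (intro divide_right_mono) auto
      also have "\<dots> = e / 2" using \<eta> by simp
      finally show ?thesis .
    qed
    finally show ?case using elim by simp
  qed
  thus "\<exists>no. \<forall>n\<ge>no. norm (measure (PiM {..<n} (\<lambda>_. M))
            {x\<in>space (PiM {..<n} (\<lambda>_. M)). \<bar>(\<Sum>j<n. Y (x j)) / real n - expectation Y\<bar> \<ge> \<eta>} - 0) < e"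
    by (simp add: eventually_sequentially)
qed

text \<open>
  All events of interest depend on the first \<open>n\<close> coordinates only, so that they can be studied on finite
  products.
\<close>

lemma (in prob_space) PiM_restrict_event:
  assumes J: "finite J" and Q: "\<And>x. Q (restrict x J) = Q x"
    and [measurable]: "{x\<in>space (PiM J (\<lambda>_. M)). Q x} \<in> sets (PiM J (\<lambda>_. M))"
  shows "{x\<in>space (PiM UNIV (\<lambda>_. M)). Q x} \<in> sets (PiM UNIV (\<lambda>_. M))"
    and "measure (PiM UNIV (\<lambda>_. M)) {x\<in>space (PiM UNIV (\<lambda>_. M)). Q x}
       = measure (PiM J (\<lambda>_. M)) {x\<in>space (PiM J (\<lambda>_. M)). Q x}"
proof -
  interpret P: product_prob_space "\<lambda>_. M" UNIV by (rule product_prob_space_const)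
  let ?U = "PiM UNIV (\<lambda>_. M)" and ?J = "PiM J (\<lambda>_. M)"
  let ?A = "{x\<in>space ?J. Q x}"
  have r: "(\<lambda>x. restrict x J) \<in> measurable ?U ?J" by (intro measurable_restrict_subset) simp
  have eq: "(\<lambda>x. restrict x J) -` ?A \<inter> space ?U = {x\<in>space ?U. Q x}"
    using measurable_space[OF r] Q by auto
  show "{x\<in>space ?U. Q x} \<in> sets ?U"
    unfolding eq[symmetric] using r by (rule measurable_sets) (rule assms(3))
  have "measure ?J ?A = measure (distr ?U ?J (\<lambda>x. restrict x J)) ?A"
    using P.distr_PiM_restrict_finite[OF J subset_UNIV] by simp
  also have "\<dots> = measure ?U {x\<in>space ?U. Q x}"
    by (subst measure_distr[OF r assms(3)]) (simp only: eq)
  finally show "measure ?U {x\<in>space ?U. Q x} = measure ?J ?A" ..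
qed

lemma (in prob_space) PiM_density:
  fixes g :: "'a \<Rightarrow> real"
  assumes J: "finite J" and [measurable]: "g \<in> borel_measurable M" and g0: "\<And>x. 0 \<le> g x"
    and prob: "prob_space (density M g)"
  shows "PiM J (\<lambda>_. density M g) = density (PiM J (\<lambda>_. M)) (\<lambda>x. ennreal (\<Prod>j\<in>J. g (x j)))"
proof -
  interpret D: prob_space "density M g" by fact
  interpret P: product_prob_space "\<lambda>_. M" J by (rule product_prob_space_const)
  interpret Q: product_prob_space "\<lambda>_. density M g" J by (rule D.product_prob_space_const)
  let ?P = "PiM J (\<lambda>_. M)"
  have G: "ennreal (\<Prod>j\<in>J. g (x j)) = (\<Prod>j\<in>J. ennreal (g (x j)))" for x
    using g0 by (simp add: prod_ennreal)
  show ?thesis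
  proof (rule Q.PiM_eqI[symmetric, OF J])
    show "sets (density ?P (\<lambda>x. ennreal (\<Prod>j\<in>J. g (x j)))) = sets (PiM J (\<lambda>_. density M g))"
      unfolding sets_density by (intro sets_PiM_cong) auto
  next
    fix A assume A: "\<And>i. i \<in> J \<Longrightarrow> A i \<in> sets (density M g)"
    hence A' [measurable]: "A i \<in> sets M" if "i \<in> J" for i using that by auto
    have "emeasure (density ?P (\<lambda>x. ennreal (\<Prod>j\<in>J. g (x j)))) (Pi\<^sub>E J A)
        = (\<integral>\<^sup>+x. ennreal (\<Prod>j\<in>J. g (x j)) * indicator (Pi\<^sub>E J A) x \<partial>?P)"
      using J A' by (intro emeasure_density) (auto intro!: sets_PiM_I_finite)
    also have "\<dots> = (\<integral>\<^sup>+x. (\<Prod>j\<in>J. ennreal (g (x j)) * indicator (A j) (x j)) \<partial>?P)"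
    proof (rule nn_integral_cong)
      fix x assume "x \<in> space ?P"
      hence "(indicator (Pi\<^sub>E J A) x :: ennreal) = (\<Prod>j\<in>J. indicator (A j) (x j))"
        using J by (auto simp: indicator_def space_PiM PiE_iff)
      thus "ennreal (\<Prod>j\<in>J. g (x j)) * indicator (Pi\<^sub>E J A) x
          = (\<Prod>j\<in>J. ennreal (g (x j)) * indicator (A j) (x j))"
        by (simp add: G prod.distrib)
    qed
    also have "\<dots> = (\<Prod>j\<in>J. \<integral>\<^sup>+x. ennreal (g x) * indicator (A j) x \<partial>M)"
      using J by (intro P.product_nn_integral_prod) auto
    also have "\<dots> = (\<Prod>j\<in>J. emeasure (density M g) (A j))"
      by (intro prod.cong) (auto simp: emeasure_density)
    finally show "emeasure (density ?P (\<lambda>x. ennreal (\<Prod>j\<in>J. g (x j)))) (Pi\<^sub>E J A)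
        = (\<Prod>j\<in>J. emeasure (density M g) (A j))" .
  qed
qed

text \<open>
  The sum omits one index because the large term, which has no exponential moment of the wanted kind,
  is estimated separately from the rest of the sample.
\<close>

lemma (in prob_space) chernoff_bound_omitting_one:
  fixes F :: "'a \<Rightarrow> real" and A s :: real and n :: nat
  assumes [measurable]: "F \<in> borel_measurable M"
    and A: "(\<integral>\<^sup>+x. ennreal (exp (F x)) \<partial>M) \<le> ennreal A" "A \<ge> 0" and j: "j < n"
  shows "measure (PiM {..<n} (\<lambda>_. M))
           {x\<in>space (PiM {..<n} (\<lambda>_. M)). s \<le> (\<Sum>l\<in>{..<n} - {j}. F (x l))} \<le> A ^ (n - 1) * exp (- s)"
proof -
  let ?P = "PiM {..<n} (\<lambda>_. M)"
  interpret P: product_prob_space "\<lambda>_. M" "{..<n}" by (rule product_prob_space_const)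
  let ?S = "{x\<in>space ?P. s \<le> (\<Sum>l\<in>{..<n} - {j}. F (x l))}"
  \<comment> \<open>With the factor \<open>1\<close> at index \<open>j\<close>, the product runs over all coordinates and its integral factorises.\<close>
  define G where "G l y = (if l = j then 1 else ennreal (exp (F y)))" for l :: nat and y
  have [measurable]: "G l \<in> borel_measurable M" for l unfolding G_def by measurable
  have Fl [measurable]: "(\<lambda>x. F (x l)) \<in> borel_measurable ?P" if "l \<in> {..<n} - {j}" for l
    using that by (intro measurable_compose[OF measurable_component_singleton]) auto
  have "(\<lambda>x. \<Sum>l\<in>{..<n} - {j}. F (x l)) \<in> borel_measurable ?P"
    by (rule borel_measurable_sum) (rule Fl)
  hence Sm [measurable]: "?S \<in> sets ?P" by measurable
  have "emeasure ?P ?S = (\<integral>\<^sup>+x. indicator ?S x \<partial>?P)"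
    by (rule nn_integral_indicator[symmetric]) (rule Sm)
  also have "\<dots> \<le> (\<integral>\<^sup>+x. ennreal (exp (- s)) * (\<Prod>l<n. G l (x l)) \<partial>?P)"
  proof (rule nn_integral_mono)
    fix x assume "x \<in> space ?P"
    have "(\<Prod>l<n. G l (x l)) = (\<Prod>l\<in>{..<n} - {j}. G l (x l))"
      using j by (subst prod.remove[of _ j]) (auto simp: G_def)
    also have "\<dots> = (\<Prod>l\<in>{..<n} - {j}. ennreal (exp (F (x l))))"
      by (intro prod.cong) (auto simp: G_def)
    also have "\<dots> = ennreal (exp (\<Sum>l\<in>{..<n} - {j}. F (x l)))"
      by (simp add: prod_ennreal exp_sum)
    finally have eq: "ennreal (exp (- s)) * (\<Prod>l<n. G l (x l))
        = ennreal (exp ((\<Sum>l\<in>{..<n} - {j}. F (x l)) - s))"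
      by (simp add: ennreal_mult[symmetric] exp_diff exp_minus field_simps)
    show "indicator ?S x \<le> ennreal (exp (- s)) * (\<Prod>l<n. G l (x l))"
      unfolding eq by (auto simp: indicator_def simp flip: ennreal_1 intro!: ennreal_leI)
  qed
  also have "\<dots> = ennreal (exp (- s)) * (\<integral>\<^sup>+x. (\<Prod>l<n. G l (x l)) \<partial>?P)"
    by (rule nn_integral_cmult) measurable
  also have "(\<integral>\<^sup>+x. (\<Prod>l<n. G l (x l)) \<partial>?P) = (\<Prod>l<n. \<integral>\<^sup>+x. G l x \<partial>M)"
    by (rule P.product_nn_integral_prod) auto
  also have "\<dots> = (\<integral>\<^sup>+x. G j x \<partial>M) * (\<Prod>l\<in>{..<n} - {j}. \<integral>\<^sup>+x. G l x \<partial>M)"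
    using j by (intro prod.remove) auto
  also have "(\<integral>\<^sup>+x. G j x \<partial>M) = 1" by (simp add: G_def emeasure_space_1)
  also have "1 * (\<Prod>l\<in>{..<n} - {j}. \<integral>\<^sup>+x. G l x \<partial>M) = (\<Prod>l\<in>{..<n} - {j}. \<integral>\<^sup>+x. G l x \<partial>M)" by simp
  also have "\<dots> \<le> (\<Prod>l\<in>{..<n} - {j}. ennreal A)"
    using A by (intro prod_mono_ennreal) (auto simp: G_def)
  also have "\<dots> = ennreal (A ^ (n - 1))"
    using j A by (simp add: ennreal_power)
  finally have "emeasure ?P ?S \<le> ennreal (exp (- s)) * ennreal (A ^ (n - 1))"
    by (simp add: mult_left_mono)
  also have "\<dots> = ennreal (A ^ (n - 1) * exp (- s))"
    using A by (simp add: ennreal_mult[symmetric] mult.commute)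
  finally show ?thesis
    using A by (simp add: P.emeasure_eq_measure)
qed

section \<open>Moments and relative entropy of densities\<close>

text \<open>
  The bound \<open>r\<close> on the entropy is an upper bound instead of its value, so that the relation is the
  epigraph of a function of \<open>v\<close> and is convex. For a probability measure \<open>N\<close>, the integral
  \<open>\<integral> g ln g dN\<close> is the entropy of \<open>g dN\<close> relative to \<open>N\<close>.
\<close>

definition attains ::
    "'a measure \<Rightarrow> 'i set \<Rightarrow> ('i \<Rightarrow> 'a \<Rightarrow> real) \<Rightarrow> ('i \<Rightarrow> real) \<Rightarrow> real \<Rightarrow> bool" where
  "attains N I \<phi> v r \<longleftrightarrow> (\<exists>g. (\<forall>x. 0 \<le> g x) \<and> has_bochner_integral N g 1 \<and>
     (\<forall>i\<in>I. has_bochner_integral N (\<lambda>x. g x * \<phi> i x) (v i)) \<and>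
     integrable N (\<lambda>x. g x * ln (g x)) \<and> (\<integral>x. g x * ln (g x) \<partial>N) \<le> r)"

lemma attains_cong:
  assumes "attains N I \<phi> v r" "\<And>i. i \<in> I \<Longrightarrow> v i = w i"
  shows "attains N I \<phi> w r"
proof -
  from assms(1) obtain g where g: "\<forall>x. 0 \<le> g x" "has_bochner_integral N g 1"
     "\<forall>i\<in>I. has_bochner_integral N (\<lambda>x. g x * \<phi> i x) (v i)"
     "integrable N (\<lambda>x. g x * ln (g x))" "(\<integral>x. g x * ln (g x) \<partial>N) \<le> r"
    unfolding attains_def by blast
  show ?thesis
    unfolding attains_def using g by (intro exI[of _ g]) (simp add: assms(2)[symmetric])
qed

text \<open>
  Tangent lines of the convex function \<open>x ln x\<close>, which is extended by \<open>0\<close> to \<open>x = 0\<close>. They yield its convexity,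
  the nonnegativity of relative entropy, and the integrability of the negative part of \<open>g ln g\<close>.
\<close>

lemma mult_ln_tangent:
  fixes x y :: real
  assumes "x \<ge> 0" "y > 0"
  shows "x * ln x \<ge> y * ln y + (1 + ln y) * (x - y)"
proof (cases "x = 0")
  case False
  hence x: "x > 0" using assms by simp
  have "ln (y / x) \<le> y / x - 1" using x assms by (intro ln_le_minus_one) simp
  hence "x * ln (y / x) \<le> x * (y / x - 1)" using x by (intro mult_left_mono) auto
  thus ?thesis using x assms by (simp add: ln_div algebra_simps)
qed (use assms in \<open>simp add: algebra_simps\<close>)

lemma mult_ln_ge: "x \<ge> 0 \<Longrightarrow> x * ln x \<ge> x - (1::real)"
  using mult_ln_tangent[of x 1] by simp

lemma mult_ln_convex:
  fixes x y t :: real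
  assumes "x \<ge> 0" "y \<ge> 0" "0 \<le> t" "t \<le> 1"
  defines "z \<equiv> (1 - t) * x + t * y"
  shows "z * ln z \<le> (1 - t) * (x * ln x) + t * (y * ln y)"
proof (cases "z = 0")
  case True
  hence "(1 - t) * x = 0" "t * y = 0"
    using assms by (auto simp: z_def add_nonneg_eq_0_iff)
  thus ?thesis using True by auto
next
  case False
  hence z: "z > 0" using assms by (simp add: z_def less_le)
  have "(1 - t) * (z * ln z + (1 + ln z) * (x - z)) + t * (z * ln z + (1 + ln z) * (y - z))
      \<le> (1 - t) * (x * ln x) + t * (y * ln y)"
    using mult_ln_tangent[OF assms(1) z] mult_ln_tangent[OF assms(2) z] assms
    by (intro add_mono mult_left_mono) auto
  also have "(1 - t) * (z * ln z + (1 + ln z) * (x - z)) + t * (z * ln z + (1 + ln z) * (y - z))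
      = z * ln z + (1 + ln z) * ((1 - t) * x + t * y - z)"
    by (simp add: algebra_simps)
  also have "\<dots> = z * ln z" by (simp add: z_def)
  finally show ?thesis .
qed

lemma (in prob_space) attains_nonneg:
  assumes "attains M I \<phi> v r"
  shows "r \<ge> 0"
proof -
  obtain g where g: "\<And>x. 0 \<le> g x" "has_bochner_integral M g 1"
     "integrable M (\<lambda>x. g x * ln (g x))" "(\<integral>x. g x * ln (g x) \<partial>M) \<le> r"
    using assms unfolding attains_def by blast
  have "(\<integral>x. g x - 1 \<partial>M) \<le> (\<integral>x. g x * ln (g x) \<partial>M)"
    using g mult_ln_ge by (intro integral_mono) (auto simp: has_bochner_integral_iff)
  moreover have "(\<integral>x. g x - 1 \<partial>M) = 0"
    using g by (simp add: has_bochner_integral_iff prob_space)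
  ultimately show ?thesis using g by simp
qed

lemma (in prob_space) attains_convex:
  assumes "attains M I \<phi> v r" "attains M I \<phi> w s" and t: "0 \<le> t" "t \<le> 1"
  shows "attains M I \<phi> (\<lambda>i. (1 - t) * v i + t * w i) ((1 - t) * r + t * s)"
proof -
  obtain g where g: "\<And>x. 0 \<le> g x" "has_bochner_integral M g 1"
     "\<And>i. i \<in> I \<Longrightarrow> has_bochner_integral M (\<lambda>x. g x * \<phi> i x) (v i)"
     "integrable M (\<lambda>x. g x * ln (g x))" "(\<integral>x. g x * ln (g x) \<partial>M) \<le> r"
    using assms(1) unfolding attains_def by blast
  obtain h where h: "\<And>x. 0 \<le> h x" "has_bochner_integral M h 1"
     "\<And>i. i \<in> I \<Longrightarrow> has_bochner_integral M (\<lambda>x. h x * \<phi> i x) (w i)"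
     "integrable M (\<lambda>x. h x * ln (h x))" "(\<integral>x. h x * ln (h x) \<partial>M) \<le> s"
    using assms(2) unfolding attains_def by blast
  define f where "f x = (1 - t) * g x + t * h x" for x
  have [measurable]: "g \<in> borel_measurable M" "h \<in> borel_measurable M"
    using g(2) h(2) by (auto simp: has_bochner_integral_iff)
  have [measurable]: "f \<in> borel_measurable M" unfolding f_def by measurable
  define u where "u x = (1 - t) * (g x * ln (g x)) + t * (h x * ln (h x))" for x
  have u_int: "integrable M u" unfolding u_def using g h by auto
  have f0: "f x \<ge> 0" for x unfolding f_def using g h t by auto
  have le: "f x * ln (f x) \<le> u x" for x
    unfolding f_def u_def using g h t by (intro mult_ln_convex) auto
  have f1: "has_bochner_integral M f 1"
    using has_bochner_integral_add[OF has_bochner_integral_mult_right[of "1 - t", OF g(2)]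
        has_bochner_integral_mult_right[of t, OF h(2)]] by (simp add: f_def[abs_def])
  have f_int: "integrable M (\<lambda>x. f x * ln (f x))"
  proof (rule Bochner_Integration.integrable_bound)
    show "integrable M (\<lambda>x. \<bar>u x\<bar> + (f x + 1))"
      using u_int f1 by (auto simp: has_bochner_integral_iff)
    show "AE x in M. norm (f x * ln (f x)) \<le> norm (\<bar>u x\<bar> + (f x + 1))"
    proof (rule AE_I2)
      fix x
      show "norm (f x * ln (f x)) \<le> norm (\<bar>u x\<bar> + (f x + 1))"
        using le[of x] mult_ln_ge[OF f0[of x]] f0[of x] unfolding real_norm_def by linarith
    qed
  qed simp
  have "(\<integral>x. f x * ln (f x) \<partial>M) \<le> (\<integral>x. u x \<partial>M)"
    using f_int u_int le by (intro integral_mono) auto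
  also have "\<dots> = (1 - t) * (\<integral>x. g x * ln (g x) \<partial>M) + t * (\<integral>x. h x * ln (h x) \<partial>M)"
    unfolding u_def using g h by simp
  also have "\<dots> \<le> (1 - t) * r + t * s"
    using g h t by (intro add_mono mult_left_mono) auto
  finally have "(\<integral>x. f x * ln (f x) \<partial>M) \<le> (1 - t) * r + t * s" .
  moreover have "has_bochner_integral M (\<lambda>x. f x * \<phi> i x) ((1 - t) * v i + t * w i)" if "i \<in> I" for i
  proof -
    have "has_bochner_integral M (\<lambda>x. (1 - t) * (g x * \<phi> i x) + t * (h x * \<phi> i x))
        ((1 - t) * v i + t * w i)"
      using that g h by (intro has_bochner_integral_add has_bochner_integral_mult_right) auto
    also have "(\<lambda>x. (1 - t) * (g x * \<phi> i x) + t * (h x * \<phi> i x)) = (\<lambda>x. f x * \<phi> i x)"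
      unfolding f_def by (simp only: distrib_right mult.assoc)
    finally show ?thesis .
  qed
  ultimately show ?thesis
    unfolding attains_def using f0 f1 f_int by blast
qed

text \<open>
  Change of measure. Under the law with density \<open>g\<close> the moments are the desired ones, and so is the
  average of \<open>ln g\<close>, whose mean is at most \<open>r\<close>. On the event where all these averages are close to
  their means, the density \<open>\<Prod>g(x\<^sub>j)\<close> of the new product law is at most \<open>e\<^bsup>n(r+\<eta>)\<^esup>\<close>, and by the weak law
  this event has probability at least \<open>1/2\<close> under the new law.
\<close>

lemma (in prob_space) entropy_lower_bound:
  fixes r \<delta> \<eta> :: real
  assumes I: "finite I" and \<phi> [measurable]: "\<And>i. i \<in> I \<Longrightarrow> \<phi> i \<in> borel_measurable M"
    and att: "attains M I \<phi> v r" and "\<delta> > 0" "\<eta> > 0"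
  shows "\<forall>\<^sub>F n in sequentially. exp (- (r + \<eta>) * n) / 2 \<le>
     measure (PiM {..<n} (\<lambda>_. M))
       {x\<in>space (PiM {..<n} (\<lambda>_. M)). \<forall>i\<in>I. \<bar>(\<Sum>j<n. \<phi> i (x j)) / real n - v i\<bar> \<le> \<delta>}"
proof -
  obtain g where g0: "\<And>x. 0 \<le> g x" and g1: "has_bochner_integral M g 1"
     and g\<phi>: "\<And>i. i \<in> I \<Longrightarrow> has_bochner_integral M (\<lambda>x. g x * \<phi> i x) (v i)"
     and gl: "integrable M (\<lambda>x. g x * ln (g x))" and glr: "(\<integral>x. g x * ln (g x) \<partial>M) \<le> r"
    using att unfolding attains_def by blast
  have gm [measurable]: "g \<in> borel_measurable M" using g1 by (auto simp: has_bochner_integral_iff)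
  let ?D = "density M g"
  have "emeasure ?D (space ?D) = (\<integral>\<^sup>+x. ennreal (g x) \<partial>M)"
    by (simp add: emeasure_density nn_integral_cong[of M "\<lambda>x. ennreal (g x) * indicator (space M) x"])
  also have "\<dots> = 1"
    using g1 g0 by (subst nn_integral_eq_integral) (auto simp: has_bochner_integral_iff)
  finally have prob: "prob_space ?D" by (intro prob_spaceI)
  interpret D: prob_space ?D by fact
  have int\<phi>: "integrable ?D (\<phi> i)" "D.expectation (\<phi> i) = v i" if "i \<in> I" for i
    using g\<phi>[OF that] g0 that
    by (simp_all add: has_bochner_integral_iff integrable_real_density integral_real_density)
  have intl: "integrable ?D (\<lambda>x. ln (g x))" "D.expectation (\<lambda>x. ln (g x)) \<le> r"
    using gl glr g0 by (simp_all add: integrable_real_density integral_real_density)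
  define Bi where "Bi i n = {x\<in>space (PiM {..<n} (\<lambda>_. ?D)). \<bar>(\<Sum>j<n. \<phi> i (x j)) / real n - v i\<bar> \<ge> \<delta>}" for i n
  define Bl where "Bl n = {x\<in>space (PiM {..<n} (\<lambda>_. ?D)).
      \<bar>(\<Sum>j<n. ln (g (x j))) / real n - D.expectation (\<lambda>x. ln (g x))\<bar> \<ge> \<eta>}" for n
  have "(\<lambda>n. measure (PiM {..<n} (\<lambda>_. ?D)) (Bl n) + (\<Sum>i\<in>I. measure (PiM {..<n} (\<lambda>_. ?D)) (Bi i n)))
      \<longlonglongrightarrow> 0 + (\<Sum>i\<in>I. 0)"
  proof (intro tendsto_add tendsto_sum)
    show "(\<lambda>n. measure (PiM {..<n} (\<lambda>_. ?D)) (Bl n)) \<longlonglongrightarrow> 0"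
      unfolding Bl_def using \<open>\<eta> > 0\<close> intl by (intro D.weak_law_of_large_numbers)
    show "(\<lambda>n. measure (PiM {..<n} (\<lambda>_. ?D)) (Bi i n)) \<longlonglongrightarrow> 0" if "i \<in> I" for i
      using D.weak_law_of_large_numbers[OF int\<phi>(1)[OF that] \<open>\<delta> > 0\<close>]
      unfolding Bi_def int\<phi>(2)[OF that] .
  qed
  from order_tendstoD(2)[OF this, of "1/2"]
  have "\<forall>\<^sub>F n in sequentially.
      measure (PiM {..<n} (\<lambda>_. ?D)) (Bl n) + (\<Sum>i\<in>I. measure (PiM {..<n} (\<lambda>_. ?D)) (Bi i n)) < 1/2"
    by simp
  thus ?thesis
    using eventually_gt_at_top[of 0]
  proof eventually_elim
    case (elim n)
    let ?P = "PiM {..<n} (\<lambda>_. M)" and ?Q = "PiM {..<n} (\<lambda>_. ?D)"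
    interpret P: product_prob_space "\<lambda>_. M" "{..<n}" by (rule product_prob_space_const)
    interpret Q: product_prob_space "\<lambda>_. ?D" "{..<n}" by (rule D.product_prob_space_const)
    have sQ: "space ?Q = space ?P" by (simp add: space_PiM)
    have setsQ: "sets ?Q = sets ?P" by (intro sets_PiM_cong) auto
    define C where "C = {x\<in>space ?P. \<forall>i\<in>I. \<bar>(\<Sum>j<n. \<phi> i (x j)) / real n - v i\<bar> \<le> \<delta>}"
    have avg [measurable]: "(\<lambda>x. (\<Sum>j<n. \<phi> i (x j)) / real n) \<in> borel_measurable ?P" if "i \<in> I" for i
      using \<phi>[OF that] by (rule borel_measurable_average)
    have Cm [measurable]: "C \<in> sets ?P"
      unfolding C_def
      by (intro sets.sets_Collect_finite_All borel_measurable_le borel_measurable_abs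
            borel_measurable_diff avg borel_measurable_const I)
    have Bm: "Bi i n \<in> sets ?Q" if "i \<in> I" for i
      unfolding Bi_def sQ setsQ
      by (intro borel_measurable_le borel_measurable_abs borel_measurable_diff avg
            borel_measurable_const that)
    have Blm: "Bl n \<in> sets ?Q"
      unfolding Bl_def sQ setsQ
      by (intro borel_measurable_le borel_measurable_abs borel_measurable_diff
            borel_measurable_average borel_measurable_const) measurable
    define U where "U = Bl n \<union> (\<Union>i\<in>I. Bi i n)"
    have Um: "U \<in> sets ?Q" unfolding U_def using Bm Blm I by auto
    have "Q.prob U \<le> Q.prob (Bl n) + Q.prob (\<Union>i\<in>I. Bi i n)"
      unfolding U_def using Bm Blm I by (intro measure_Un_le) auto
    also have "Q.prob (\<Union>i\<in>I. Bi i n) \<le> (\<Sum>i\<in>I. Q.prob (Bi i n))"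
      using I Bm by (intro Q.finite_measure_subadditive_finite) auto
    finally have "Q.prob U < 1/2" using elim by simp
    hence half: "1/2 \<le> Q.prob (space ?Q - U)" using Q.prob_compl[OF Um] by simp
    have Gm [measurable]: "space ?Q - U \<in> sets ?P" using Um setsQ by auto
    have "emeasure ?Q (space ?Q - U)
        = (\<integral>\<^sup>+x. ennreal (\<Prod>j<n. g (x j)) * indicator (space ?Q - U) x \<partial>?P)"
      by (subst PiM_density[OF _ gm g0 prob], simp, subst emeasure_density) auto
    also have "\<dots> \<le> (\<integral>\<^sup>+x. ennreal (exp ((r + \<eta>) * n)) * indicator C x \<partial>?P)"
    proof (rule nn_integral_mono)
      fix x assume xP: "x \<in> space ?P"
      show "ennreal (\<Prod>j<n. g (x j)) * indicator (space ?Q - U) x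
          \<le> ennreal (exp ((r + \<eta>) * n)) * indicator C x"
      proof (cases "x \<in> U")
        case False
        hence "x \<in> C" using xP sQ by (auto simp: C_def U_def Bi_def)
        moreover have "(\<Prod>j<n. g (x j)) \<le> exp ((r + \<eta>) * n)"
        proof (cases "\<exists>j<n. g (x j) = 0")
          case True
          hence "(\<Prod>j<n. g (x j)) = 0" by auto
          thus ?thesis by (simp only:) simp
        next
          case nz: False
          hence pos: "g (x j) > 0" if "j < n" for j using that g0[of "x j"] by (auto simp: less_le)
          have "\<not> \<bar>(\<Sum>j<n. ln (g (x j))) / real n - D.expectation (\<lambda>x. ln (g x))\<bar> \<ge> \<eta>"
            using False xP sQ by (auto simp: U_def Bl_def)
          hence "(\<Sum>j<n. ln (g (x j))) / real n \<le> r + \<eta>" using intl(2) by linarith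
          hence "(\<Sum>j<n. ln (g (x j))) \<le> (r + \<eta>) * n" using elim by (simp add: field_simps)
          hence "exp (\<Sum>j<n. ln (g (x j))) \<le> exp ((r + \<eta>) * n)" by simp
          also have "exp (\<Sum>j<n. ln (g (x j))) = (\<Prod>j<n. g (x j))"
            using pos by (simp add: exp_sum)
          finally show ?thesis .
        qed
        ultimately show ?thesis by (auto simp: indicator_def intro!: ennreal_leI)
      qed auto
    qed
    also have "\<dots> = ennreal (exp ((r + \<eta>) * n)) * emeasure ?P C"
      by (subst nn_integral_cmult_indicator) auto
    finally have "Q.prob (space ?Q - U) \<le> exp ((r + \<eta>) * n) * P.prob C"
      by (simp add: Q.emeasure_eq_measure P.emeasure_eq_measure ennreal_mult[symmetric])
    hence "1/2 \<le> exp ((r + \<eta>) * n) * P.prob C" using half by linarith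
    hence "exp (- (r + \<eta>) * n) * (1/2) \<le> exp (- (r + \<eta>) * n) * (exp ((r + \<eta>) * n) * P.prob C)"
      by (intro mult_left_mono) auto
    also have "\<dots> = P.prob C"
      by (simp only: mult.assoc[symmetric] exp_add[symmetric] mult_minus_left) simp
    finally show ?case by (simp add: C_def)
  qed
qed

text \<open>
  The density \<open>e\<^bsup>p\<cdot>\<phi>\<^esup>/Z\<close> on a set \<open>B\<close> where the \<open>\<phi>\<^sub>i\<close> are bounded: all integrals exist, and the entropy is
  \<open>p\<cdot>v - ln Z\<close> for its moment vector \<open>v\<close>. For \<open>p = 0\<close> this is the law conditioned on \<open>B\<close>.
\<close>

lemma (in prob_space) attains_tilted:
  fixes \<phi> :: "'i \<Rightarrow> 'a \<Rightarrow> real" and p :: "'i \<Rightarrow> real"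
  assumes I: "finite I" and \<phi> [measurable]: "\<And>i. i \<in> I \<Longrightarrow> \<phi> i \<in> borel_measurable M"
    and B [measurable]: "B \<in> sets M" and B_pos: "prob B > 0"
    and bd: "\<And>i x. i \<in> I \<Longrightarrow> x \<in> B \<Longrightarrow> \<bar>\<phi> i x\<bar> \<le> K"
  shows "\<exists>g Z. (\<forall>x. 0 \<le> g x) \<and> has_bochner_integral M g 1 \<and> (\<forall>x. x \<notin> B \<longrightarrow> g x = 0) \<and>
    (\<forall>i\<in>I. integrable M (\<lambda>x. g x * \<phi> i x)) \<and>
    (\<integral>\<^sup>+x. ennreal (exp (\<Sum>i\<in>I. p i * \<phi> i x)) * indicator B x \<partial>M) = ennreal Z \<and> Z > 0 \<and>
    attains M I \<phi> (\<lambda>i. \<integral>x. g x * \<phi> i x \<partial>M) ((\<Sum>i\<in>I. p i * (\<integral>x. g x * \<phi> i x \<partial>M)) - ln Z)"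
proof -
  define F where "F x = (\<Sum>i\<in>I. p i * \<phi> i x)" for x
  have [measurable]: "F \<in> borel_measurable M" unfolding F_def by measurable
  define L where "L = (\<Sum>i\<in>I. \<bar>p i\<bar> * K)"
  have FL: "\<bar>F x\<bar> \<le> L" if "x \<in> B" for x
    unfolding F_def L_def
    by (rule order.trans[OF sum_abs]) (intro sum_mono, auto simp: abs_mult intro!: mult_left_mono bd that)
  define e where "e x = exp (F x) * indicator B x" for x
  have [measurable]: "e \<in> borel_measurable M" unfolding e_def by measurable
  have e0: "e x \<ge> 0" for x by (simp add: e_def)
  have bounded_int: "integrable M (\<lambda>x. e x * h x)"
    if [measurable]: "h \<in> borel_measurable M" and h: "\<And>x. x \<in> B \<Longrightarrow> \<bar>h x\<bar> \<le> C" for h C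
  proof (rule integrable_const_bound[where B = "exp L * C"])
    have "\<bar>e x * h x\<bar> \<le> exp L * C" if "x \<in> B" for x
    proof -
      have "F x \<le> L" using FL[OF that] by simp
      thus ?thesis using h[OF that] that by (auto simp: e_def abs_mult intro!: mult_mono)
    qed
    moreover have "0 \<le> exp L * C" 
    proof -
      have "B \<noteq> {}" using B_pos by auto
      thus ?thesis using h by fastforce
    qed
    ultimately show "AE x in M. norm (e x * h x) \<le> exp L * C"
      by (intro AE_I2) (auto simp: e_def indicator_def)
  qed simp
  have e_int: "integrable M e" using bounded_int[of "\<lambda>_. 1" 1] by simp
  define Z where "Z = (\<integral>x. e x \<partial>M)"
  have "Z \<ge> (\<integral>x. exp (- L) * indicator B x \<partial>M)"
    unfolding Z_def
  proof (rule integral_mono[OF _ e_int])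
    show "integrable M (\<lambda>x. exp (- L) * indicator B x)"
      by (intro integrable_mult_right integrable_real_indicator) (auto simp: emeasure_eq_measure)
    fix x
    show "exp (- L) * indicator B x \<le> e x"
      using FL[of x] by (auto simp: e_def indicator_def abs_le_iff)
  qed
  hence "Z \<ge> exp (- L) * prob B" by simp
  moreover have "exp (- L) * prob B > 0" using B_pos by simp
  ultimately have Z: "Z > 0" by linarith
  define g where "g x = e x / Z" for x
  have g0: "g x \<ge> 0" for x using e0 Z by (simp add: g_def)
  have [measurable]: "g \<in> borel_measurable M" unfolding g_def by measurable
  have g1: "has_bochner_integral M g 1"
    using e_int Z by (simp add: has_bochner_integral_iff g_def[abs_def] Z_def)
  have gi: "integrable M (\<lambda>x. g x * h x)"
    if "h \<in> borel_measurable M" "\<And>x. x \<in> B \<Longrightarrow> \<bar>h x\<bar> \<le> C" for h C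
  proof -
    have "(\<lambda>x. g x * h x) = (\<lambda>x. e x * h x / Z)" by (simp add: g_def)
    thus ?thesis using bounded_int[OF that] by simp
  qed
  have g\<phi>: "integrable M (\<lambda>x. g x * \<phi> i x)" if "i \<in> I" for i
    using that bd by (intro gi[of _ K]) auto
  have gF: "integrable M (\<lambda>x. g x * F x)" using FL by (intro gi[of _ L]) auto
  have gl: "g x * ln (g x) = g x * F x - ln Z * g x" for x
  proof (cases "x \<in> B")
    case True
    hence lng: "ln (g x) = F x - ln Z" using Z by (simp add: g_def e_def ln_div)
    show ?thesis unfolding lng by (simp add: algebra_simps)
  qed (simp add: g_def e_def)
  have "(\<integral>x. g x * F x \<partial>M) = (\<integral>x. (\<Sum>i\<in>I. p i * (g x * \<phi> i x)) \<partial>M)"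
    by (simp only: F_def sum_distrib_left mult.left_commute)
  also have "\<dots> = (\<Sum>i\<in>I. p i * (\<integral>x. g x * \<phi> i x \<partial>M))"
    using g\<phi> by (subst Bochner_Integration.integral_sum) auto
  finally have "(\<integral>x. g x * ln (g x) \<partial>M) = (\<Sum>i\<in>I. p i * (\<integral>x. g x * \<phi> i x \<partial>M)) - ln Z"
    unfolding gl using gF g1 by (simp add: has_bochner_integral_iff)
  hence ent: "(\<integral>x. g x * ln (g x) \<partial>M) \<le> (\<Sum>i\<in>I. p i * (\<integral>x. g x * \<phi> i x \<partial>M)) - ln Z" by simp
  have entI: "integrable M (\<lambda>x. g x * ln (g x))"
    unfolding gl using gF g1 by (simp add: has_bochner_integral_iff)
  have att: "attains M I \<phi> (\<lambda>i. \<integral>x. g x * \<phi> i x \<partial>M) ((\<Sum>i\<in>I. p i * (\<integral>x. g x * \<phi> i x \<partial>M)) - ln Z)"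
    unfolding attains_def
    by (intro exI[of _ g] conjI ballI allI g0 g1 ent entI has_bochner_integral_integrable g\<phi>)
  have "(\<integral>\<^sup>+x. ennreal (exp (F x)) * indicator B x \<partial>M) = (\<integral>\<^sup>+x. ennreal (e x) \<partial>M)"
    by (intro nn_integral_cong) (auto simp: e_def indicator_def)
  also have "\<dots> = ennreal Z"
    unfolding Z_def using e_int e0 by (intro nn_integral_eq_integral) auto
  finally have eZ: "(\<integral>\<^sup>+x. ennreal (exp (F x)) * indicator B x \<partial>M) = ennreal Z" .
  have gB: "g x = 0" if "x \<notin> B" for x using that by (simp add: g_def e_def)
  show ?thesis
    by (intro exI[of _ g] exI[of _ Z] conjI allI impI ballI g0 g1 gB g\<phi> eZ[unfolded F_def] Z att)
qed

section \<open>The constraint functions and the reference law\<close>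

text \<open>
  The growth gap makes the \<open>\<phi>\<^sub>i\<close> a scale: each is negligible against the next one at infinity. All
  facts below about large values of \<open>\<phi>\<^sub>k\<close> and about linear combinations of the \<open>\<phi>\<^sub>i\<close> come from it.
\<close>

locale constraint_functions =
  fixes k :: nat and phi :: "nat \<Rightarrow> real \<Rightarrow> real"
  assumes k: "k \<ge> 2"
    and phi_pos: "\<And>i x. i \<in> {1..k} \<Longrightarrow> x > 0 \<Longrightarrow> phi i x > 0"
    and phi_mono: "\<And>i. i \<in> {1..k} \<Longrightarrow> mono_on {0<..} (phi i)"
    and phi_lim: "\<And>i. i \<in> {1..k} \<Longrightarrow> filterlim (phi i) at_top at_top"
    and phi_int: "(\<integral>\<^sup>+x. ennreal (exp (- phi 1 x)) \<partial>pos_lborel) < \<infinity>"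
    and phi_gap: "\<exists>\<kappa>>1. \<forall>i\<in>{1..k-1}. \<forall>\<^sub>F x in at_top. phi i x powr \<kappa> < phi (i + 1) x"
begin

abbreviation "lam \<equiv> lambda_measure phi"

lemma index_bounds: "1 \<in> {1..k}" "k \<in> {1..k}" using k by auto

lemma space_pos [simp]: "space pos_lborel = {0<..}"
  by (simp add: pos_lborel_def space_restrict_space)

lemma sets_lambda: "sets lam = sets pos_lborel"
  by (simp add: lambda_measure_def Let_def)

lemma space_lambda [simp]: "space lam = {0<..}"
  using sets_eq_imp_space_eq[OF sets_lambda] by simp

lemma phi_measurable_pos: "i \<in> {1..k} \<Longrightarrow> phi i \<in> borel_measurable pos_lborel"
proof -
  assume "i \<in> {1..k}"
  moreover have "sets pos_lborel = sets (restrict_space borel {0<..})"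
    unfolding pos_lborel_def by (intro sets_restrict_space_cong) simp
  ultimately show ?thesis
    using borel_measurable_mono_on_fnc[OF phi_mono] measurable_cong_sets by blast
qed

lemma phi_measurable: "i \<in> {1..k} \<Longrightarrow> phi i \<in> borel_measurable lam"
  using phi_measurable_pos measurable_cong_sets[OF sets_lambda refl] by blast

lemma interval_sets: "0 \<le> x \<Longrightarrow> {x<..y} \<in> sets pos_lborel"
  unfolding pos_lborel_def by (subst sets_restrict_space_iff) auto

lemma emeasure_interval: "0 \<le> x \<Longrightarrow> x \<le> y \<Longrightarrow> emeasure pos_lborel {x<..y} = ennreal (y - x)"
  unfolding pos_lborel_def by (subst emeasure_restrict_space) auto

definition Z :: real where "Z = (\<integral>x. exp (- phi 1 x) \<partial>pos_lborel)"

lemma integrable_exp_phi1: "integrable pos_lborel (\<lambda>x. exp (- phi 1 x))"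
  using phi_int phi_measurable_pos[OF index_bounds(1)]
  by (intro integrableI_nonneg) auto

lemma Z_pos: "Z > 0"
proof -
  have "(\<integral>x. exp (- phi 1 1) * indicator {0<..1} x \<partial>pos_lborel) \<le> Z"
    unfolding Z_def
  proof (rule integral_mono[OF _ integrable_exp_phi1])
    show "integrable pos_lborel (\<lambda>x. exp (- phi 1 1) * indicator {0<..1} x)"
      using interval_sets[of 0 1] emeasure_interval[of 0 1]
      by (intro integrable_mult_right integrable_real_indicator) auto
    fix x assume "x \<in> space pos_lborel"
    thus "exp (- phi 1 1) * indicator {0<..1} x \<le> exp (- phi 1 x)"
      using mono_onD[OF phi_mono[OF index_bounds(1)], of x 1] by (auto simp: indicator_def)
  qed
  moreover have "(\<integral>x. exp (- phi 1 1) * indicator {0<..1} x \<partial>pos_lborel) = exp (- phi 1 1)"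
  proof -
    have "{0<..1::real} \<inter> {0<..} = {0<..1}" by auto
    thus ?thesis
      using interval_sets[of 0 1] emeasure_interval[of 0 1] by (simp add: measure_def)
  qed
  moreover have "exp (- phi 1 1) > 0" by simp
  ultimately show ?thesis by linarith
qed

definition dens :: "real \<Rightarrow> real" where "dens x = 1 / Z * exp (- phi 1 x)"

lemma dens_pos: "dens x > 0" using Z_pos by (simp add: dens_def)

lemma dens_measurable [measurable]: "dens \<in> borel_measurable pos_lborel"
  unfolding dens_def using phi_measurable_pos[OF index_bounds(1)] by measurable

lemma lambda_density: "lam = density pos_lborel (\<lambda>x. ennreal (dens x))"
  by (simp add: lambda_measure_def Let_def Z_def dens_def)

lemma prob_space_lambda: "prob_space lam"
proof (rule prob_spaceI)
  have "emeasure lam (space lam) = (\<integral>\<^sup>+x. ennreal (dens x) \<partial>pos_lborel)"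
  proof -
    have "{0<..} \<in> sets pos_lborel" using sets.top[of pos_lborel] by simp
    hence "emeasure lam (space lam) = (\<integral>\<^sup>+x. ennreal (dens x) * indicator {0<..} x \<partial>pos_lborel)"
      unfolding space_lambda unfolding lambda_density by (subst emeasure_density) auto
    also have "\<dots> = (\<integral>\<^sup>+x. ennreal (dens x) \<partial>pos_lborel)"
      by (intro nn_integral_cong) auto
    finally show ?thesis .
  qed
  also have "\<dots> = ennreal (\<integral>x. dens x \<partial>pos_lborel)"
    using integrable_exp_phi1 dens_pos
    by (intro nn_integral_eq_integral) (auto simp: dens_def[abs_def] less_imp_le)
  also have "(\<integral>x. dens x \<partial>pos_lborel) = 1"
    using Z_pos by (simp add: dens_def[abs_def] Z_def)
  finally show "emeasure lam (space lam) = 1" by simp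
qed

sublocale N: prob_space lam by (rule prob_space_lambda)

lemma measure_interval_pos:
  assumes "0 \<le> x" "x < y"
  shows "N.prob {x<..y} > 0"
proof -
  have "0 < ennreal (dens y) * emeasure pos_lborel {x<..y}"
    using assms dens_pos by (simp add: emeasure_interval ennreal_mult[symmetric] less_imp_le)
  also have "\<dots> = (\<integral>\<^sup>+t. ennreal (dens y) * indicator {x<..y} t \<partial>pos_lborel)"
    using assms by (intro nn_integral_cmult_indicator[symmetric] interval_sets)
  also have "\<dots> \<le> (\<integral>\<^sup>+t. ennreal (dens t) * indicator {x<..y} t \<partial>pos_lborel)"
  proof (rule nn_integral_mono)
    fix t assume "t \<in> space pos_lborel"
    thus "ennreal (dens y) * indicator {x<..y} t \<le> ennreal (dens t) * indicator {x<..y} t"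
      using mono_onD[OF phi_mono[OF index_bounds(1)], of t y] Z_pos
      by (auto simp: indicator_def dens_def intro!: ennreal_leI divide_right_mono)
  qed
  also have "\<dots> = emeasure lam {x<..y}"
    unfolding lambda_density using assms interval_sets by (subst emeasure_density) auto
  finally show ?thesis by (simp add: N.emeasure_eq_measure)
qed

text \<open>
  For neighbours, \<open>\<phi>\<^sub>i / \<phi>\<^bsub>i+1\<^esub> \<le> \<phi>\<^sub>i\<^bsup>1-\<kappa>\<^esup>\<close> eventually; in general the ratio is a product of such ratios.
\<close>

lemma phi_ratio_tendsto:
  assumes "1 \<le> i" "i < j" "j \<le> k"
  shows "((\<lambda>x. phi i x / phi j x) \<longlongrightarrow> 0) at_top"
proof -
  obtain \<kappa> where \<kappa>: "\<kappa> > 1" "\<And>i. i \<in> {1..k-1} \<Longrightarrow> \<forall>\<^sub>F x in at_top. phi i x powr \<kappa> < phi (i + 1) x"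
    using phi_gap by blast
  have step: "((\<lambda>x. phi i x / phi (Suc i) x) \<longlongrightarrow> 0) at_top" if i: "1 \<le> i" "Suc i \<le> k" for i
  proof (rule tendsto_sandwich[OF _ _ tendsto_const])
    show "\<forall>\<^sub>F x in at_top. 0 \<le> phi i x / phi (Suc i) x"
      using eventually_gt_at_top[of 0]
      by eventually_elim (use phi_pos[of i] phi_pos[of "Suc i"] i in \<open>auto intro!: divide_nonneg_nonneg less_imp_le\<close>)
    have "i \<in> {1..k-1}" using i by auto
    from \<kappa>(2)[OF this] eventually_gt_at_top[of 0]
    show "\<forall>\<^sub>F x in at_top. phi i x / phi (Suc i) x \<le> phi i x powr (1 - \<kappa>)"
    proof eventually_elim
      case (elim x)
      have p: "phi i x > 0" "phi (Suc i) x > 0" using phi_pos i elim by auto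
      have "phi i x / phi (Suc i) x \<le> phi i x / (phi i x powr \<kappa>)"
        using elim p by (intro divide_left_mono) auto
      also have "\<dots> = phi i x powr (1 - \<kappa>)" using p by (simp add: powr_diff)
      finally show ?case .
    qed
    have "((\<lambda>y::real. y powr (1 - \<kappa>)) \<longlongrightarrow> 0) at_top"
      using \<kappa>(1) by (intro tendsto_neg_powr filterlim_ident) auto
    thus "((\<lambda>x. phi i x powr (1 - \<kappa>)) \<longlongrightarrow> 0) at_top"
      by (rule filterlim_compose) (use phi_lim i in auto)
  qed
  have "Suc i \<le> j" using assms by simp
  from this assms(3) show ?thesis
  proof (induction j rule: dec_induct)
    case base
    then show ?case using step assms by auto
  next
    case (step j)
    have "((\<lambda>x. phi i x / phi j x * (phi j x / phi (Suc j) x)) \<longlongrightarrow> 0 * 0) at_top"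
      using step assms by (intro tendsto_mult \<open>\<And>i. 1 \<le> i \<Longrightarrow> Suc i \<le> k \<Longrightarrow> _ i\<close>) auto
    moreover have "\<forall>\<^sub>F x in at_top. phi i x / phi j x * (phi j x / phi (Suc j) x) = phi i x / phi (Suc j) x"
      using eventually_gt_at_top[of 0]
    proof eventually_elim
      case (elim x)
      have "phi j x > 0" using phi_pos[of j x] elim step assms by auto
      thus ?case by simp
    qed
    ultimately have "((\<lambda>x. phi i x / phi (Suc j) x) \<longlongrightarrow> 0 * 0) at_top"
      by (rule Lim_transform_eventually)
    thus ?case by simp
  qed
qed

lemma top_coefficient_dominates:
  assumes j: "j \<in> {1..k}" "c j > 0" and z: "\<And>i. i \<in> {j<..k} \<Longrightarrow> c i = 0"
  shows "filterlim (\<lambda>x. \<Sum>i=1..k. c i * phi i x) at_top at_top"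
proof -
  have "((\<lambda>x. \<Sum>i\<in>{1..<j}. c i * (phi i x / phi j x)) \<longlongrightarrow> (\<Sum>i\<in>{1..<j}. c i * 0)) at_top"
    using j by (intro tendsto_sum tendsto_mult tendsto_const phi_ratio_tendsto) auto
  hence "((\<lambda>x. c j + (\<Sum>i\<in>{1..<j}. c i * (phi i x / phi j x))) \<longlongrightarrow> c j + 0) at_top"
    by (intro tendsto_add tendsto_const) simp
  hence "filterlim (\<lambda>x. (c j + (\<Sum>i\<in>{1..<j}. c i * (phi i x / phi j x))) * phi j x) at_top at_top"
    using j phi_lim by (intro filterlim_tendsto_pos_mult_at_top[where c = "c j"]) auto
  moreover have "\<forall>\<^sub>F x in at_top. (c j + (\<Sum>i\<in>{1..<j}. c i * (phi i x / phi j x))) * phi j x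
      = (\<Sum>i=1..k. c i * phi i x)"
    using eventually_gt_at_top[of 0]
  proof eventually_elim
    case (elim x)
    have pj: "phi j x > 0" using phi_pos[of j x] elim j by auto
    have "{1..k} = {1..<j} \<union> {j} \<union> {j<..k}" using j by auto
    hence "(\<Sum>i=1..k. c i * phi i x) = (\<Sum>i\<in>{1..<j} \<union> {j} \<union> {j<..k}. c i * phi i x)" by simp
    also have "\<dots> = (\<Sum>i\<in>{1..<j}. c i * phi i x) + c j * phi j x + (\<Sum>i\<in>{j<..k}. c i * phi i x)"
      by (subst sum.union_disjoint, simp, simp, force)+ simp
    also have "(\<Sum>i\<in>{j<..k}. c i * phi i x) = 0" using z by simp
    finally show ?case using pj by (simp add: distrib_right sum_distrib_right)
  qed
  ultimately show ?thesis by (simp add: filterlim_cong)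
qed

definition mgf :: "(nat \<Rightarrow> real) \<Rightarrow> ennreal" where
  "mgf p = (\<integral>\<^sup>+x. ennreal (exp (\<Sum>i=1..k. p i * phi i x)) \<partial>lam)"

lemma lin_measurable: "(\<lambda>x. \<Sum>i=1..k. p i * phi i x) \<in> borel_measurable lam"
  by (intro borel_measurable_sum borel_measurable_times borel_measurable_const phi_measurable)

text \<open>
  With \<open>p\<^sub>k > 0\<close>, the exponent \<open>p\<cdot>\<phi> - \<phi>\<^sub>1\<close> tends to infinity because \<open>\<phi>\<^sub>k\<close> dominates \<open>\<phi>\<^sub>1\<close>, so the integrand is
  eventually bounded below by a positive constant on a set of infinite length. This uses \<open>k \<ge> 2\<close>.
\<close>

lemma mgf_finite_imp_nonpos:
  assumes "mgf p < \<infinity>"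
  shows "p k \<le> 0"
proof (rule ccontr)
  assume "\<not> p k \<le> 0"
  define c where "c i = p i - (if i = 1 then 1 else 0)" for i :: nat
  have "filterlim (\<lambda>x. \<Sum>i=1..k. c i * phi i x) at_top at_top"
    using \<open>\<not> p k \<le> 0\<close> k by (intro top_coefficient_dominates[of k]) (auto simp: c_def)
  hence "\<forall>\<^sub>F x in at_top. 0 \<le> (\<Sum>i=1..k. c i * phi i x)"
    by (simp add: filterlim_at_top)
  then obtain R0 where R0: "\<And>x. x \<ge> R0 \<Longrightarrow> 0 \<le> (\<Sum>i=1..k. c i * phi i x)"
    by (auto simp: eventually_at_top_linorder)
  define R where "R = max R0 0"
  have c_eq: "(\<Sum>i=1..k. c i * phi i x) = (\<Sum>i=1..k. p i * phi i x) - phi 1 x" for x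
  proof -
    have "(\<Sum>i=1..k. (if i = 1 then 1 else 0) * phi i x) = phi 1 x"
      using k by (simp add: if_distrib[of "\<lambda>t. t * _"] cong: if_cong)
    thus ?thesis by (simp add: c_def left_diff_distrib sum_subtractf)
  qed
  have [measurable]: "(\<lambda>x. \<Sum>i=1..k. p i * phi i x) \<in> borel_measurable pos_lborel"
    using lin_measurable measurable_cong_sets[OF sets_lambda refl] by blast
  have "ennreal y \<le> mgf p" if "y \<ge> 0" for y
  proof -
    define T where "T = R + Z * y"
    have T: "R \<le> T" "0 \<le> R" using that Z_pos by (auto simp: T_def R_def)
    have "ennreal y = ennreal (1 / Z) * emeasure pos_lborel {R<..T}"
      using T Z_pos that by (simp add: emeasure_interval ennreal_mult[symmetric] T_def)
    also have "\<dots> = (\<integral>\<^sup>+x. ennreal (1 / Z) * indicator {R<..T} x \<partial>pos_lborel)"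
      using T by (intro nn_integral_cmult_indicator[symmetric] interval_sets)
    also have "\<dots> \<le> (\<integral>\<^sup>+x. ennreal (dens x) * ennreal (exp (\<Sum>i=1..k. p i * phi i x)) \<partial>pos_lborel)"
    proof (rule nn_integral_mono)
      fix x
      show "ennreal (1 / Z) * indicator {R<..T} x \<le> ennreal (dens x) * ennreal (exp (\<Sum>i=1..k. p i * phi i x))"
      proof (cases "x \<in> {R<..T}")
        case True
        hence "0 \<le> (\<Sum>i=1..k. p i * phi i x) - phi 1 x"
          using R0[of x] c_eq[of x] by (auto simp: R_def)
        hence "1 \<le> exp ((\<Sum>i=1..k. p i * phi i x) - phi 1 x)" by simp
        hence "1 / Z \<le> dens x * exp (\<Sum>i=1..k. p i * phi i x)"
          using Z_pos by (simp add: dens_def exp_diff exp_minus field_simps)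
        thus ?thesis using True dens_pos[of x] by (simp add: ennreal_mult[symmetric] ennreal_leI less_imp_le)
      qed simp
    qed
    also have "\<dots> = mgf p"
      unfolding mgf_def lambda_density by (rule nn_integral_density[symmetric]) measurable
    finally show ?thesis .
  qed
  note le = this
  from assms obtain y where y: "y \<ge> 0" "mgf p = ennreal y" by (cases "mgf p") auto
  have "ennreal (y + 1) \<le> ennreal y" using le[of "y + 1"] y by simp
  thus False using y by (simp add: ennreal_le_iff)
qed

text \<open>
  The last nonzero coefficient decides the behaviour at infinity, so a nontrivial combination is
  unbounded there, whereas intervals have positive mass.
\<close>

lemma lin_nonconstant:
  assumes ae: "AE x in lam. (\<Sum>i=1..k. d i * phi i x) = c" and i: "i \<in> {1..k}"
  shows "d i = 0"
proof (rule ccontr)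
  assume "d i \<noteq> 0"
  define S where "S = {i\<in>{1..k}. d i \<noteq> 0}"
  have S: "finite S" "S \<noteq> {}" using i \<open>d i \<noteq> 0\<close> by (auto simp: S_def)
  define j where "j = Max S"
  have jS: "j \<in> S" unfolding j_def using S by (rule Max_in)
  have top: "d l = 0" if "l \<in> {j<..k}" for l
    using that Max_ge[OF S(1), of l] by (cases "l \<in> S") (auto simp: j_def[symmetric], auto simp: S_def)
  define e where "e = sgn (d j)"
  have "filterlim (\<lambda>x. \<Sum>i=1..k. (e * d i) * phi i x) at_top at_top"
  proof (rule top_coefficient_dominates)
    show "j \<in> {1..k}" using jS by (simp add: S_def)
    show "e * d j > 0" using jS by (auto simp: S_def e_def sgn_if)
    show "e * d l = 0" if "l \<in> {j<..k}" for l using top[OF that] by simp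
  qed
  hence "\<forall>\<^sub>F x in at_top. e * c < (\<Sum>i=1..k. (e * d i) * phi i x)"
    by (simp add: filterlim_at_top_dense)
  then obtain R0 where R0: "\<And>x. x \<ge> R0 \<Longrightarrow> e * c < (\<Sum>i=1..k. (e * d i) * phi i x)"
    by (auto simp: eventually_at_top_linorder)
  define R where "R = max R0 0"
  have ne: "(\<Sum>i=1..k. d i * phi i x) \<noteq> c" if "x \<in> {R<..R+1}" for x
  proof -
    have "e * c < (\<Sum>i=1..k. (e * d i) * phi i x)" using that by (intro R0) (simp add: R_def)
    also have "\<dots> = e * (\<Sum>i=1..k. d i * phi i x)" by (simp only: sum_distrib_left mult.assoc)
    finally show ?thesis by auto
  qed
  have "AE x in lam. x \<notin> {R<..R+1}"
    using ae by eventually_elim (use ne in auto)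
  hence "N.prob {R<..R+1} = 0"
    using interval_sets[of R "R+1"] sets_lambda by (subst N.prob_eq_0) (auto simp: R_def)
  thus False using measure_interval_pos[of R "R+1"] by (auto simp: R_def)
qed

end

section \<open>Attainable moments near an admissible point\<close>

context constraint_functions begin

abbreviation "att \<equiv> attains lam {1..k} phi"

lemma tilted_interval:
  assumes "0 \<le> x" "x < y"
  shows "\<exists>g Z. (\<forall>t. 0 \<le> g t) \<and> has_bochner_integral lam g 1 \<and> (\<forall>t. t \<notin> {x<..y} \<longrightarrow> g t = 0) \<and>
    (\<forall>i\<in>{1..k}. integrable lam (\<lambda>t. g t * phi i t)) \<and>
    (\<integral>\<^sup>+t. ennreal (exp (\<Sum>i=1..k. p i * phi i t)) * indicator {x<..y} t \<partial>lam) = ennreal Z \<and> Z > 0 \<and>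
    att (\<lambda>i. \<integral>t. g t * phi i t \<partial>lam) ((\<Sum>i=1..k. p i * (\<integral>t. g t * phi i t \<partial>lam)) - ln Z)"
proof (rule N.attains_tilted[where K = "\<Sum>i=1..k. phi i y"])
  show "{x<..y} \<in> sets lam" unfolding sets_lambda using assms by (intro interval_sets)
  show "N.prob {x<..y} > 0" using assms by (intro measure_interval_pos)
  fix i t assume t: "i \<in> {1..k}" "t \<in> {x<..y}"
  have "t > 0" using t assms by auto
  have "\<bar>phi i t\<bar> = phi i t" using phi_pos[OF t(1) \<open>t > 0\<close>] by simp
  also have "\<dots> \<le> phi i y"
    using t assms by (intro mono_onD[OF phi_mono]) auto
  also have "\<dots> \<le> (\<Sum>i=1..k. phi i y)"
    using t assms phi_pos by (intro member_le_sum) (auto intro!: less_imp_le)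
  finally show "\<bar>phi i t\<bar> \<le> (\<Sum>i=1..k. phi i y)" .
qed (use phi_measurable in auto)

text \<open>
  A measure with \<open>h(\<mu>) \<noteq> -\<infinity>\<close> has a density \<open>f\<close> with respect to Lebesgue measure; with respect to \<open>\<lambda>\<close> its density is \<open>g = f Z e\<^bsup>\<phi>\<^sub>1\<^esup>\<close>, hence
  \<open>\<integral> g ln g d\<lambda> = \<integral> f ln f dx + ln Z + \<integral> \<phi>\<^sub>1 f dx\<close>. The finite first moment bounds the integral of the negative
  part of \<open>f ln f\<close>; then \<open>h(\<mu>) \<noteq> -\<infinity>\<close> says that the integral of its positive part is finite as well.
\<close>

lemma moment_measure_attains:
  assumes mu: "mu \<in> moment_measures k phi v" and v: "\<And>i. i \<in> {1..k-1} \<Longrightarrow> v i > 0"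
    and fin: "(\<integral>\<^sup>+ x. ennreal (phi k x) \<partial>mu) < \<infinity>"
  shows "\<exists>r. att (v(k := enn2real (\<integral>\<^sup>+ x. ennreal (phi k x) \<partial>mu))) r"
proof -
  define u where "u = v(k := enn2real (\<integral>\<^sup>+ x. ennreal (phi k x) \<partial>mu))"
  have prob: "prob_space mu" and sets: "sets mu = sets pos_lborel"
    and ent: "diff_entropy mu \<noteq> - \<infinity>"
    and mom: "\<And>i. i \<in> {1..k-1} \<Longrightarrow> (\<integral>\<^sup>+ x. ennreal (phi i x) \<partial>mu) = ennreal (v i)"
    using mu by (auto simp: moment_measures_def pos_prob_measures_def)
  interpret mu: prob_space mu by fact
  interpret L: sigma_finite_measure pos_lborel
    unfolding pos_lborel_def by (intro sigma_finite_measure_restrict_space lborel.sigma_finite_measure_axioms) simp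
  have ac: "absolutely_continuous pos_lborel mu"
    using ent by (auto simp: diff_entropy_def split: if_splits)
  define f where "f x = enn2real (RN_deriv pos_lborel mu x)" for x
  have [measurable]: "f \<in> borel_measurable pos_lborel" unfolding f_def by measurable
  have f0: "f x \<ge> 0" for x by (simp add: f_def)
  have "AE x in pos_lborel. RN_deriv pos_lborel mu x \<noteq> \<infinity>"
    by (rule L.RN_deriv_finite[OF _ ac sets]) (rule mu.sigma_finite_measure_axioms)
  hence "AE x in pos_lborel. RN_deriv pos_lborel mu x = ennreal (f x)"
    by eventually_elim (auto simp: f_def less_top)
  hence "density pos_lborel (RN_deriv pos_lborel mu) = density pos_lborel (\<lambda>x. ennreal (f x))"
    by (intro density_cong) auto
  hence mu_eq: "mu = density pos_lborel (\<lambda>x. ennreal (f x))"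
    using L.density_RN_deriv[OF ac sets] by simp
  have phm [measurable]: "phi i \<in> borel_measurable pos_lborel" if "i \<in> {1..k}" for i
    using that by (rule phi_measurable_pos)
  have momf: "(\<integral>\<^sup>+ x. ennreal (f x * phi i x) \<partial>pos_lborel) = ennreal (u i)" if i: "i \<in> {1..k}" for i
  proof -
    have "(\<integral>\<^sup>+ x. ennreal (f x * phi i x) \<partial>pos_lborel)
        = (\<integral>\<^sup>+ x. ennreal (f x) * ennreal (phi i x) \<partial>pos_lborel)"
      using f0 by (intro nn_integral_cong) (simp add: ennreal_mult')
    also have "\<dots> = (\<integral>\<^sup>+ x. ennreal (phi i x) \<partial>mu)"
      unfolding mu_eq using i by (intro nn_integral_density[symmetric]) auto
    also have "\<dots> = ennreal (u i)"
    proof (cases "i = k")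
      case True
      thus ?thesis using fin by (simp add: u_def)
    next
      case False
      hence "i \<in> {1..k-1}" using i by auto
      thus ?thesis using False by (simp add: u_def mom)
    qed
    finally show ?thesis .
  qed
  have u0: "u i \<ge> 0" if i: "i \<in> {1..k}" for i
  proof (cases "i = k")
    case False
    hence "i \<in> {1..k-1}" using i by auto
    thus ?thesis using False v[of i] by (simp add: u_def)
  qed (simp add: u_def)
  have hb: "has_bochner_integral pos_lborel (\<lambda>x. f x * phi i x) (u i)" if i: "i \<in> {1..k}" for i
  proof (rule has_bochner_integral_nn_integral)
    show "AE x in pos_lborel. 0 \<le> f x * phi i x"
      using f0 phi_pos[OF i] by (intro AE_I2 mult_nonneg_nonneg) (auto intro: less_imp_le)
  qed (use i momf u0 in auto)
  have f1: "has_bochner_integral pos_lborel f 1"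
  proof (rule has_bochner_integral_nn_integral)
    have "(\<integral>\<^sup>+ x. ennreal (f x) \<partial>pos_lborel) = emeasure mu (space mu)"
      unfolding mu_eq using sets.top[of pos_lborel]
      by (subst emeasure_density) (auto intro!: nn_integral_cong)
    thus "(\<integral>\<^sup>+ x. ennreal (f x) \<partial>pos_lborel) = ennreal 1" by (simp add: mu.emeasure_space_1)
  qed (use f0 in auto)
  let ?P = "\<integral>\<^sup>+ x. ennreal (- (f x * ln (f x))) \<partial>pos_lborel"
  let ?Q = "\<integral>\<^sup>+ x. ennreal (f x * ln (f x)) \<partial>pos_lborel"
  have "?P \<le> (\<integral>\<^sup>+ x. ennreal (f x * phi 1 x) + ennreal (exp (- phi 1 x)) \<partial>pos_lborel)"
  proof (rule nn_integral_mono)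
    fix x assume "x \<in> space pos_lborel"
    hence "phi 1 x > 0" using phi_pos[OF index_bounds(1)] by simp
    \<comment> \<open>The tangent at \<open>e\<^bsup>-\<phi>\<^sub>1\<^esup>\<close> compares \<open>f\<close> with the reference density.\<close>
    have "f x * ln (f x) \<ge> exp (- phi 1 x) * ln (exp (- phi 1 x))
        + (1 + ln (exp (- phi 1 x))) * (f x - exp (- phi 1 x))"
      using f0 by (intro mult_ln_tangent) auto
    hence "- (f x * ln (f x)) \<le> f x * phi 1 x + exp (- phi 1 x)"
      using f0[of x] by (simp add: algebra_simps)
    thus "ennreal (- (f x * ln (f x))) \<le> ennreal (f x * phi 1 x) + ennreal (exp (- phi 1 x))"
      using f0[of x] \<open>phi 1 x > 0\<close> by (simp add: ennreal_plus[symmetric] ennreal_leI del: ennreal_plus)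
  qed
  also have "\<dots> = (\<integral>\<^sup>+ x. ennreal (f x * phi 1 x) \<partial>pos_lborel) + (\<integral>\<^sup>+ x. ennreal (exp (- phi 1 x)) \<partial>pos_lborel)"
    using phm[OF index_bounds(1)] by (intro nn_integral_add) auto
  also have "\<dots> < \<infinity>" using momf[OF index_bounds(1)] phi_int by (simp add: ennreal_add_less_top)
  finally have P: "?P < \<infinity>" .
  have Q: "?Q < \<infinity>"
  proof (rule ccontr)
    assume "\<not> ?Q < \<infinity>"
    hence "?Q = \<infinity>" by (simp add: not_less top_unique)
    moreover obtain c where "c \<ge> 0" "?P = ennreal c"
      using P by (cases "?P") auto
    ultimately have "enn2ereal ?P - enn2ereal ?Q = - \<infinity>" by simp
    moreover have "diff_entropy mu = enn2ereal ?P - enn2ereal ?Q"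
      using ac by (simp add: diff_entropy_def f_def Let_def)
    ultimately show False using ent by (simp only:)
  qed
  have fl: "integrable pos_lborel (\<lambda>x. f x * ln (f x))"
    unfolding real_integrable_def using P Q by (auto simp: less_top)
  define g where "g x = f x * (Z * exp (phi 1 x))" for x
  have [measurable]: "g \<in> borel_measurable pos_lborel"
    unfolding g_def using phm[OF index_bounds(1)] by measurable
  have g0: "g x \<ge> 0" for x using f0 Z_pos by (simp add: g_def)
  have wg: "dens x * g x = f x" for x
    using Z_pos by (simp add: dens_def g_def exp_minus)
  have lift: "has_bochner_integral lam h c"
    if "has_bochner_integral pos_lborel (\<lambda>x. dens x * h x) c" "h \<in> borel_measurable pos_lborel" for h c
    unfolding lambda_density using that dens_pos
    by (intro has_bochner_integral_density) (auto intro: less_imp_le)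
  have wgl: "dens x * (g x * ln (g x)) = f x * ln (f x) + ln Z * f x + f x * phi 1 x" for x
  proof (cases "f x = 0")
    case False
    hence fx: "f x > 0" using f0[of x] by simp
    have "ln (g x) = ln (f x) + (ln Z + phi 1 x)"
      unfolding g_def using fx Z_pos by (simp add: ln_mult)
    hence "dens x * (g x * ln (g x)) = f x * (ln (f x) + (ln Z + phi 1 x))"
      using wg[of x] by (simp only: mult.assoc[symmetric])
    thus ?thesis by (simp add: algebra_simps)
  qed (simp add: g_def)
  have "has_bochner_integral pos_lborel (\<lambda>x. dens x * (g x * ln (g x)))
      (\<integral>x. f x * ln (f x) + ln Z * f x + f x * phi 1 x \<partial>pos_lborel)"
    unfolding wgl using fl f1 hb[OF index_bounds(1)]
    by (intro has_bochner_integral_integrable Bochner_Integration.integrable_add integrable_mult_right)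
       (auto simp: has_bochner_integral_iff)
  hence gl: "has_bochner_integral lam (\<lambda>x. g x * ln (g x))
      (\<integral>x. f x * ln (f x) + ln Z * f x + f x * phi 1 x \<partial>pos_lborel)"
    by (intro lift) auto
  have g1: "has_bochner_integral lam g 1" using f1 by (intro lift) (auto simp: wg)
  have gp: "has_bochner_integral lam (\<lambda>x. g x * phi i x) (u i)" if "i \<in> {1..k}" for i
    using hb[OF that] phm[OF that] by (intro lift) (auto simp: mult.assoc[symmetric] wg)
  have "att u (\<integral>x. f x * ln (f x) + ln Z * f x + f x * phi 1 x \<partial>pos_lborel)"
    unfolding attains_def using g0 g1 gp gl
    by (intro exI[of _ g]) (auto simp: has_bochner_integral_iff)
  thus ?thesis unfolding u_def by blast
qed

lemma adm1_fibre:
  assumes v: "v \<in> adm1 k phi" and c: "g1 k phi v < c"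
  shows "\<exists>b r. 0 \<le> b \<and> b < c \<and> att (v(k := b)) r"
proof -
  have "v \<in> {v \<in> {1..k-1} \<rightarrow>\<^sub>E {0<..}.
        \<exists>mu\<in>moment_measures k phi v. (\<integral>\<^sup>+ x. ennreal (phi k x) \<partial>mu) < \<infinity>}"
    using v unfolding adm1_def by (rule subsetD[OF interior_of_subset])
  then obtain mu where v0: "\<And>i. i \<in> {1..k-1} \<Longrightarrow> v i > 0"
    and mu: "mu \<in> moment_measures k phi v" "(\<integral>\<^sup>+ x. ennreal (phi k x) \<partial>mu) < \<infinity>"
    by (auto simp: PiE_iff)
  define J where "J = (INF mu\<in>moment_measures k phi v. \<integral>\<^sup>+ x. ennreal (phi k x) \<partial>mu)"
  have "J \<le> (\<integral>\<^sup>+ x. ennreal (phi k x) \<partial>mu)" unfolding J_def using mu(1) by (rule INF_lower)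
  hence "J < \<infinity>" using mu(2) by (rule order.strict_trans1)
  hence "J = ennreal (enn2real J)" by simp
  also have "enn2real J < c" using c by (simp add: g1_def J_def)
  hence "ennreal (enn2real J) < ennreal c" using enn2real_nonneg[of J] by (intro ennreal_lessI) linarith+
  finally have "J < ennreal c" .
  then obtain nu where nu: "nu \<in> moment_measures k phi v" "(\<integral>\<^sup>+ x. ennreal (phi k x) \<partial>nu) < ennreal c"
    unfolding J_def INF_less_iff by blast
  let ?b = "enn2real (\<integral>\<^sup>+ x. ennreal (phi k x) \<partial>nu)"
  have fin: "(\<integral>\<^sup>+ x. ennreal (phi k x) \<partial>nu) < \<infinity>" using nu(2) by (rule order.strict_trans) simp
  hence "ennreal ?b < ennreal c" using nu(2) by simp
  hence "?b < c" by (simp add: ennreal_less_iff)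
  moreover obtain r where "att (v(k := ?b)) r"
    using moment_measure_attains[OF nu(1) v0 fin] by blast
  ultimately show ?thesis by (intro exI[of _ ?b] exI[of _ r]) auto
qed

text \<open>
  Conditioning \<open>\<lambda>\<close> on a unit interval far out gives a law whose last moment is huge, while the other
  moments are negligible against it.
\<close>

lemma far_measure:
  assumes "\<eta> > 0"
  obtains m r where "att m r" "m k \<ge> L" "\<And>i. i \<in> {1..k-1} \<Longrightarrow> 0 \<le> m i \<and> m i \<le> \<eta> * m k"
proof -
  have "\<forall>\<^sub>F x in at_top. \<forall>i\<in>{1..k-1}. phi i x / phi k x < \<eta>"
    using \<open>\<eta> > 0\<close> k by (intro eventually_ball_finite ballI order_tendstoD(2)[OF phi_ratio_tendsto]) auto
  moreover have "\<forall>\<^sub>F x in at_top. L \<le> phi k x"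
    using phi_lim[OF index_bounds(2)] by (simp add: filterlim_at_top)
  ultimately have "\<forall>\<^sub>F x in at_top. (\<forall>i\<in>{1..k-1}. phi i x / phi k x < \<eta>) \<and> L \<le> phi k x"
    by (rule eventually_conj)
  then obtain R0 where "\<forall>x\<ge>R0. (\<forall>i\<in>{1..k-1}. phi i x / phi k x < \<eta>) \<and> L \<le> phi k x"
    unfolding eventually_at_top_linorder by blast
  hence R0: "\<And>x i. x \<ge> R0 \<Longrightarrow> i \<in> {1..k-1} \<Longrightarrow> phi i x / phi k x < \<eta>"
      "\<And>x. x \<ge> R0 \<Longrightarrow> L \<le> phi k x"
    by blast+
  define R where "R = max R0 0"
  define B where "B = {R<..R+1}"
  have R: "R \<ge> 0" "R \<ge> R0" by (auto simp: R_def)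
  obtain g Z' where g: "\<forall>x. 0 \<le> g x" "has_bochner_integral lam g 1" "\<forall>x. x \<notin> B \<longrightarrow> g x = 0"
    "\<forall>i\<in>{1..k}. integrable lam (\<lambda>x. g x * phi i x)"
    "att (\<lambda>i. \<integral>x. g x * phi i x \<partial>lam) ((\<Sum>i=1..k. 0 * (\<integral>x. g x * phi i x \<partial>lam)) - ln Z')"
    using tilted_interval[of R "R + 1" "\<lambda>_. 0", OF R(1) less_add_one] unfolding B_def by blast
  define m where "m i = (\<integral>x. g x * phi i x \<partial>lam)" for i
  show ?thesis
  proof (rule that[of m])
    show "att m ((\<Sum>i=1..k. 0 * (\<integral>x. g x * phi i x \<partial>lam)) - ln Z')"
      using g(5) unfolding m_def .
    have "(\<integral>x. g x * L \<partial>lam) \<le> m k"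
      unfolding m_def
    proof (rule integral_mono)
      show "integrable lam (\<lambda>x. g x * L)" using g(2) by (auto simp: has_bochner_integral_iff)
      show "integrable lam (\<lambda>x. g x * phi k x)" using g(4) index_bounds(2) by blast
      show "g x * L \<le> g x * phi k x" for x
        using g(1) g(3) R0(2)[of x] R by (cases "x \<in> B") (auto simp: B_def intro!: mult_left_mono)
    qed
    thus "m k \<ge> L" using g(2) by (simp add: has_bochner_integral_iff)
    fix i assume i: "i \<in> {1..k-1}"
    hence ik: "i \<in> {1..k}" by auto
    have "0 \<le> m i"
      unfolding m_def using g(1) phi_pos[OF ik]
      by (intro Bochner_Integration.integral_nonneg_AE AE_I2 mult_nonneg_nonneg) (auto intro: less_imp_le)
    moreover have "m i \<le> (\<integral>x. \<eta> * (g x * phi k x) \<partial>lam)"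
      unfolding m_def
    proof (rule integral_mono)
      show "integrable lam (\<lambda>x. g x * phi i x)" using g(4) ik by blast
      show "integrable lam (\<lambda>x. \<eta> * (g x * phi k x))" using g(4) index_bounds(2) by auto
      fix x assume "x \<in> space lam"
      hence x: "x > 0" by simp
      show "g x * phi i x \<le> \<eta> * (g x * phi k x)"
      proof (cases "x \<in> B")
        case True
        hence "phi i x / phi k x < \<eta>" using R0(1)[of x i] i R by (auto simp: B_def)
        hence "phi i x \<le> \<eta> * phi k x" using phi_pos[OF index_bounds(2) x] by (simp add: field_simps)
        hence "g x * phi i x \<le> g x * (\<eta> * phi k x)" using g(1) by (intro mult_left_mono) auto
        thus ?thesis by (simp only: mult.left_commute)
      qed (simp add: g(3))
    qed
    hence "m i \<le> \<eta> * m k" by (simp add: m_def)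
    ultimately show "0 \<le> m i \<and> m i \<le> \<eta> * m k" ..
  qed
qed

text \<open>
  The definition of \<open>g\<^sub>1\<close> only provides measures whose last moment is smaller than required. Mixing in a
  little of a far measure raises the last moment beyond any bound; the lower moments are corrected by
  starting from a slightly shifted point \<open>u\<close> of the box. A convex combination then hits the last
  moment exactly.
\<close>

lemma raise_last_moment:
  assumes fibre: "\<And>u. (\<forall>i\<in>{1..k-1}. \<bar>u i - a i\<bar> < \<rho>) \<Longrightarrow> \<exists>b r. 0 \<le> b \<and> b < c \<and> att (u(k := b)) r"
    and v: "\<forall>i\<in>{1..k-1}. \<bar>v i - a i\<bar> < \<rho>" and vk: "c \<le> v k"
  shows "\<exists>r. att v r"
proof -
  define V where "V = v k"
  obtain b0 r0 where b0: "0 \<le> b0" "b0 < c" "att (v(k := b0)) r0" using fibre[OF v] by blast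
  have V: "V > 0" "b0 < V" using b0 vk by (auto simp: V_def)
  have "finite {1..k-1}" "{1..k-1} \<noteq> {}" using k by auto
  define \<sigma> where "\<sigma> = (MIN i\<in>{1..k-1}. \<rho> - \<bar>v i - a i\<bar>)"
  have \<sigma>: "\<sigma> > 0" "\<And>i. i \<in> {1..k-1} \<Longrightarrow> \<bar>v i - a i\<bar> + \<sigma> \<le> \<rho>"
  proof -
    show "\<sigma> > 0" unfolding \<sigma>_def using v \<open>{1..k-1} \<noteq> {}\<close> by (subst Min_gr_iff) auto
    fix i assume "i \<in> {1..k-1}"
    hence "\<sigma> \<le> \<rho> - \<bar>v i - a i\<bar>" unfolding \<sigma>_def by (intro Min_le) auto
    thus "\<bar>v i - a i\<bar> + \<sigma> \<le> \<rho>" by simp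
  qed
  define K where "K = 1 + (\<Sum>i=1..k-1. \<bar>v i\<bar>)"
  have K: "K > 0" "\<And>i. i \<in> {1..k-1} \<Longrightarrow> \<bar>v i\<bar> \<le> K"
  proof -
    show "K > 0" unfolding K_def by (intro add_pos_nonneg sum_nonneg) auto
    fix i assume "i \<in> {1..k-1}"
    hence "\<bar>v i\<bar> \<le> (\<Sum>i=1..k-1. \<bar>v i\<bar>)" by (intro member_le_sum) auto
    thus "\<bar>v i\<bar> \<le> K" by (simp add: K_def)
  qed
  define L where "L = 2 * V + 8 * K * V / \<sigma>"
  have L: "L > 0" "2 * V \<le> L" "8 * K * V / \<sigma> \<le> L" using V K \<sigma> by (auto simp: L_def intro!: add_pos_pos)
  obtain m r1 where m: "att m r1" "m k \<ge> L"
      "\<And>i. i \<in> {1..k-1} \<Longrightarrow> 0 \<le> m i \<and> m i \<le> \<sigma> / (8 * V) * m k"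
    by (rule far_measure[of "\<sigma> / (8 * V)" L]) (use \<sigma> V in auto)
  \<comment> \<open>The weight of the far measure is chosen so that its contribution to the last moment is \<open>V\<close>.\<close>
  define s where "s = V / m k"
  have mk: "m k > 0" using m L by linarith
  have s: "0 < s" "s \<le> 1/2" "s * m k = V" "s * K \<le> \<sigma> / 8"
  proof -
    show "0 < s" "s * m k = V" using V mk by (auto simp: s_def)
    show "s \<le> 1/2" using m(2) L mk by (simp add: s_def field_simps)
    have "8 * K * V / \<sigma> \<le> m k" using L m(2) by linarith
    thus "s * K \<le> \<sigma> / 8" using mk \<sigma>(1) by (simp add: s_def field_simps)
  qed
  define u where "u i = (v i - s * m i) / (1 - s)" for i
  have "\<bar>u i - a i\<bar> < \<rho>" if i: "i \<in> {1..k-1}" for i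
  proof -
    have "u i - v i = s * (v i - m i) / (1 - s)" using s by (simp add: u_def field_simps)
    hence "\<bar>u i - v i\<bar> = (s * \<bar>v i - m i\<bar>) / (1 - s)" using s by (simp add: abs_mult)
    also have "\<dots> \<le> (s * \<bar>v i - m i\<bar>) / (1/2)" using s by (intro divide_left_mono) auto
    also have "s * \<bar>v i - m i\<bar> \<le> s * (K + m i)"
      using s K(2)[OF i] m(3)[OF i] by (intro mult_left_mono) auto
    also have "s * (K + m i) = s * K + s * m i" by (simp add: algebra_simps)
    also have "s * m i \<le> s * (\<sigma> / (8 * V) * m k)"
      using m(3)[OF i] s by (intro mult_left_mono) auto
    also have "s * (\<sigma> / (8 * V) * m k) = \<sigma> / 8" using V s(3) by (simp add: field_simps)
    also have "(s * K + \<sigma> / 8) / (1/2) \<le> \<sigma> / 2" using s(4) by simp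
    finally have "\<bar>u i - v i\<bar> \<le> \<sigma> / 2" by (simp add: divide_right_mono)
    thus ?thesis using \<sigma>(1) \<sigma>(2)[OF i] by linarith
  qed
  then obtain b r2 where b: "0 \<le> b" "b < c" "att (u(k := b)) r2" using fibre[of u] by blast
  define T where "T = (1 - s) * b + V"
  have T: "T \<ge> V" using b s by (simp add: T_def)
  have "att (\<lambda>i. (1 - s) * (u(k := b)) i + s * m i) ((1 - s) * r2 + s * r1)"
    using s by (intro N.attains_convex b m) auto
  hence vT: "att (v(k := T)) ((1 - s) * r2 + s * r1)"
    by (rule attains_cong) (use s in \<open>auto simp: u_def T_def\<close>)
  define t where "t = (V - b0) / (T - b0)"
  have t: "0 \<le> t" "t \<le> 1" using T V by (auto simp: t_def divide_le_eq)
  have "t * (T - b0) = V - b0" using T V by (simp add: t_def)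
  hence tV: "(1 - t) * b0 + t * T = V" by (simp add: algebra_simps)
  have "att (\<lambda>i. (1 - t) * (v(k := b0)) i + t * (v(k := T)) i)
      ((1 - t) * r0 + t * ((1 - s) * r2 + s * r1))"
    by (intro N.attains_convex b0 vT t)
  hence "att v ((1 - t) * r0 + t * ((1 - s) * r2 + s * r1))"
    by (rule attains_cong) (use tV in \<open>auto simp: V_def algebra_simps\<close>)
  thus ?thesis by blast
qed

text \<open>
  Continuity of \<open>g\<^sub>1\<close> keeps \<open>g\<^sub>1 < c < a\<^sub>k\<close> on a neighbourhood of the first \<open>k - 1\<close> coordinates of \<open>a\<close>, and
  last moments of at least \<open>c\<close> are then attainable over this neighbourhood.
\<close>

lemma admissible_box:
  assumes a: "a \<in> adm k phi"
    and cont: "continuous_map (subtopology (powertop_real {1..k-1}) (adm1 k phi))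
                    euclideanreal (g1 k phi)"
  obtains \<rho> where "\<rho> > 0" "\<And>v. (\<forall>i\<in>{1..k}. \<bar>v i - a i\<bar> < \<rho>) \<Longrightarrow> \<exists>r. att v r"
proof -
  define a' where "a' = restrict a {1..k-1}"
  have a': "a' \<in> adm1 k phi" "g1 k phi a' < a k" using a by (auto simp: adm_def a'_def)
  define c where "c = (g1 k phi a' + a k) / 2"
  have c: "g1 k phi a' < c" "c < a k" using a' by (auto simp: c_def)
  define W where "W = {v \<in> adm1 k phi. g1 k phi v < c}"
  have op: "openin (powertop_real {1..k-1}) (adm1 k phi)" unfolding adm1_def by simp
  have ts: "topspace (subtopology (powertop_real {1..k-1}) (adm1 k phi)) = adm1 k phi"
    using openin_subset[OF op] by auto
  have "openin (subtopology (powertop_real {1..k-1}) (adm1 k phi))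
      {v \<in> topspace (subtopology (powertop_real {1..k-1}) (adm1 k phi)). g1 k phi v \<in> {..<c}}"
    using cont by (rule openin_continuous_map_preimage) simp
  hence "openin (subtopology (powertop_real {1..k-1}) (adm1 k phi)) W"
    unfolding ts W_def by simp
  hence "openin (powertop_real {1..k-1}) W"
    by (rule openin_trans_full) (rule op)
  moreover have "a' \<in> W" using a' c by (simp add: W_def)
  ultimately have "\<exists>U. finite {i\<in>{1..k-1}. U i \<noteq> topspace euclideanreal} \<and>
      (\<forall>i\<in>{1..k-1}. openin euclideanreal (U i)) \<and> a' \<in> Pi\<^sub>E {1..k-1} U \<and> Pi\<^sub>E {1..k-1} U \<subseteq> W"
    unfolding openin_product_topology_alt by (rule bspec)
  then obtain U where "\<forall>i\<in>{1..k-1}. openin euclideanreal (U i)"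
      and U: "a' \<in> Pi\<^sub>E {1..k-1} U" "Pi\<^sub>E {1..k-1} U \<subseteq> W" by blast
  hence Uo: "open (U i)" if "i \<in> {1..k-1}" for i using that by simp
  have "\<forall>i\<in>{1..k-1}. \<exists>\<rho>>0. \<forall>y. \<bar>y - a i\<bar> < \<rho> \<longrightarrow> y \<in> U i"
  proof
    fix i assume i: "i \<in> {1..k-1}"
    hence "a i \<in> U i" using U(1) by (auto simp: a'_def PiE_iff)
    thus "\<exists>\<rho>>0. \<forall>y. \<bar>y - a i\<bar> < \<rho> \<longrightarrow> y \<in> U i"
      using Uo[OF i] unfolding open_dist by (auto simp: dist_real_def)
  qed
  from bchoice[OF this] obtain R
    where R: "\<forall>i\<in>{1..k-1}. R i > 0 \<and> (\<forall>y. \<bar>y - a i\<bar> < R i \<longrightarrow> y \<in> U i)" ..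
  have ne: "{1..k-1} \<noteq> {}" using k by auto
  define \<rho> where "\<rho> = Min (R ` {1..k-1})"
  have \<rho>: "\<rho> > 0" unfolding \<rho>_def using R ne by (subst Min_gr_iff) auto
  have \<rho>_le: "\<rho> \<le> R i" if "i \<in> {1..k-1}" for i
    unfolding \<rho>_def using that by (intro Min_le) auto
  have fibre: "\<exists>b r. 0 \<le> b \<and> b < c \<and> att (u(k := b)) r" if u: "\<forall>i\<in>{1..k-1}. \<bar>u i - a i\<bar> < \<rho>" for u
  proof -
    have "restrict u {1..k-1} \<in> Pi\<^sub>E {1..k-1} U"
    proof (rule restrict_PiE_iff[THEN iffD2], rule ballI)
      fix i assume i: "i \<in> {1..k-1}"
      have "\<bar>u i - a i\<bar> < R i" using bspec[OF u i] \<rho>_le[OF i] by (rule order.strict_trans2)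
      thus "u i \<in> U i" using bspec[OF R i] by blast
    qed
    hence "restrict u {1..k-1} \<in> W" using U(2) by blast
    then obtain b r where b: "0 \<le> b" "b < c" "att ((restrict u {1..k-1})(k := b)) r"
      using adm1_fibre[of "restrict u {1..k-1}" c] by (auto simp: W_def)
    have "att (u(k := b)) r"
      by (rule attains_cong[OF b(3)]) auto
    thus ?thesis using b by blast
  qed
  show ?thesis
  proof (rule that[of "min \<rho> (a k - c)"])
    show "min \<rho> (a k - c) > 0" using \<rho> c by simp
    fix v assume v: "\<forall>i\<in>{1..k}. \<bar>v i - a i\<bar> < min \<rho> (a k - c)"
    hence "\<bar>v k - a k\<bar> < a k - c" using index_bounds(2) by auto
    hence "c \<le> v k" by linarith
    moreover have "\<forall>i\<in>{1..k-1}. \<bar>v i - a i\<bar> < \<rho>" using v by auto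
    ultimately show "\<exists>r. att v r" by (intro raise_last_moment[OF fibre])
  qed
qed

text \<open>
  A supporting slope \<open>p\<close> of the entropy at \<open>a\<close>, applied to the tilts \<open>e\<^bsup>p\<cdot>\<phi>\<^esup>/Z\<^sub>R\<close> on \<open>(0,R]\<close>, yields
  \<open>m + p\<cdot>(v - a) \<le> p\<cdot>v - ln Z\<^sub>R\<close>, in which the unknown moments \<open>v\<close> of the tilt cancel. Monotone convergence
  in \<open>R\<close> gives the bound on the moment generating function.
\<close>

lemma supporting_parameter:
  assumes box: "\<rho> > 0" "\<And>v. (\<forall>i\<in>{1..k}. \<bar>v i - a i\<bar> < \<rho>) \<Longrightarrow> \<exists>r. att v r"
  obtains m p where "\<And>\<eta>. \<eta> > 0 \<Longrightarrow> \<exists>r<m+\<eta>. att a r"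
    "mgf p \<le> ennreal (exp ((\<Sum>i=1..k. p i * a i) - m))"
proof -
  define D where "D = {r. att a r}"
  have ne: "D \<noteq> {}" using box(2)[of a] box(1) by (auto simp: D_def)
  have bdd: "bdd_below D" unfolding D_def by (rule bdd_belowI[of _ 0]) (auto dest: N.attains_nonneg)
  define m where "m = Inf D"
  have "m \<le> r" if "att v r" "\<forall>i\<in>{1..k}. v i = a i" for v r
  proof -
    have "att a r" using that by (intro attains_cong[OF that(1)]) auto
    thus ?thesis unfolding m_def using bdd by (intro cInf_lower) (auto simp: D_def)
  qed
  then obtain p where p: "\<And>v r. att v r \<Longrightarrow> m + (\<Sum>i=1..k. p i * (v i - a i)) \<le> r"
    using convex_relation_subgradient[of "{1..k}" att \<rho> a m, OF _ N.attains_convex box] by auto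
  define C where "C = exp ((\<Sum>i=1..k. p i * a i) - m)"
  define f where "f n x = ennreal (exp (\<Sum>i=1..k. p i * phi i x)) * indicator {0<..real (Suc n)} x" for n x
  have Bs: "{0<..real (Suc n)} \<in> sets lam" for n unfolding sets_lambda by (intro interval_sets) simp
  have fm: "f n \<in> borel_measurable lam" for n
    unfolding f_def using Bs[of n] lin_measurable[of p] by measurable
  have le: "(\<integral>\<^sup>+x. f n x \<partial>lam) \<le> ennreal C" for n
  proof -
    let ?B = "{0<..real (Suc n)}"
    obtain g Z' where g:
      "(\<integral>\<^sup>+x. ennreal (exp (\<Sum>i=1..k. p i * phi i x)) * indicator ?B x \<partial>lam) = ennreal Z'" "Z' > 0"
      "att (\<lambda>i. \<integral>x. g x * phi i x \<partial>lam) ((\<Sum>i=1..k. p i * (\<integral>x. g x * phi i x \<partial>lam)) - ln Z')"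
      using tilted_interval[of 0 "real (Suc n)" p, OF order_refl of_nat_0_less_iff[THEN iffD2, OF zero_less_Suc]] by blast
    have "ln Z' \<le> (\<Sum>i=1..k. p i * a i) - m"
      using p[OF g(3)] by (simp add: right_diff_distrib sum_subtractf)
    hence "Z' \<le> C" unfolding C_def using g(2) by (metis exp_le_cancel_iff exp_ln)
    thus ?thesis using g(1) by (simp add: f_def ennreal_leI)
  qed
  have "mgf p \<le> (\<integral>\<^sup>+x. (SUP n. f n x) \<partial>lam)"
    unfolding mgf_def
  proof (rule nn_integral_mono)
    fix x assume "x \<in> space lam"
    moreover obtain n where "x \<le> real n" using real_arch_simple by blast
    ultimately have "ennreal (exp (\<Sum>i=1..k. p i * phi i x)) \<le> f n x"
      by (simp add: f_def indicator_def)
    thus "ennreal (exp (\<Sum>i=1..k. p i * phi i x)) \<le> (SUP n. f n x)"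
      by (rule SUP_upper2[OF UNIV_I])
  qed
  also have "\<dots> = (SUP n. \<integral>\<^sup>+x. f n x \<partial>lam)"
  proof (rule nn_integral_monotone_convergence_SUP[OF _ fm])
    show "incseq f"
      unfolding f_def by (intro incseq_SucI le_funI mult_left_mono) (auto simp: indicator_def)
  qed
  also have "\<dots> \<le> ennreal C" by (rule SUP_least) (rule le)
  finally have "mgf p \<le> ennreal C" .
  moreover have "\<exists>r<m+\<eta>. att a r" if "\<eta> > 0" for \<eta>
  proof -
    have "Inf D < m + \<eta>" using that by (simp add: m_def)
    thus ?thesis using cInf_less_iff[OF ne bdd] by (auto simp: D_def)
  qed
  ultimately show ?thesis using that unfolding C_def by blast
qed

end

section \<open>Subgradients of the log moment generating function\<close>

context constraint_functions begin

lemma mgf_restrict: "mgf (restrict p {1..k}) = mgf p"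
  unfolding mgf_def by (intro nn_integral_cong arg_cong[of _ _ ennreal] arg_cong[of _ _ exp] sum.cong) auto

lemma mgf_zero: "mgf (\<lambda>_. 0) = 1"
  unfolding mgf_def using N.emeasure_space_1 by simp

lemma exp_lin_measurable: "(\<lambda>x. ennreal (exp (\<Sum>i=1..k. p i * phi i x))) \<in> borel_measurable lam"
  using lin_measurable[of p] by measurable

lemma mgf_nonzero: "mgf p \<noteq> 0"
proof
  assume "mgf p = 0"
  hence "AE x in lam. ennreal (exp (\<Sum>i=1..k. p i * phi i x)) = 0"
    unfolding mgf_def using exp_lin_measurable by (subst (asm) nn_integral_0_iff_AE)
  hence "AE x in lam. False" by eventually_elim (simp add: ennreal_eq_0_iff not_le)
  thus False using N.AE_False by blast
qed

lemma mgf_finiteE: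
  assumes "mgf p < \<infinity>"
  obtains A where "A > 0" "mgf p = ennreal A"
  using assms mgf_nonzero[of p] by (cases "mgf p") (auto simp: less_le)

lemma log_mgf_eq: "log_mgf k phi p = elog (mgf p)"
  by (simp add: log_mgf_def mgf_def)

lemma log_mgf_finite: "A > 0 \<Longrightarrow> mgf p = ennreal A \<Longrightarrow> log_mgf k phi p = ereal (ln A)"
  by (simp add: log_mgf_eq elog_def)

text \<open>
  A subgradient inequality at a point of value \<open>\<infinity>\<close> would contradict \<open>H(0) = 0\<close>.
\<close>

lemma subdifferential_finite:
  assumes w: "w \<in> subdifferential k (log_mgf k phi) p"
  shows "mgf p < \<infinity>"
proof (rule ccontr)
  assume "\<not> mgf p < \<infinity>"
  hence "mgf p = \<infinity>" by (simp add: not_less top_unique)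
  hence F: "log_mgf k phi p = \<infinity>" by (simp add: log_mgf_eq elog_def)
  define z where "z = restrict (\<lambda>_. 0::real) {1..k}"
  have "z \<in> extensional {1..k}" by (simp add: z_def)
  hence "log_mgf k phi p + ereal (\<Sum>i=1..k. w i * (z i - p i)) \<le> log_mgf k phi z"
    using w unfolding subdifferential_def by blast
  moreover have "mgf z = ennreal 1" unfolding z_def mgf_restrict mgf_zero by simp
  hence "log_mgf k phi z = ereal 0" using log_mgf_finite[of 1 z] by simp
  ultimately show False using F by simp
qed

lemma subdifferential_le:
  assumes w: "w \<in> subdifferential k (log_mgf k phi) p"
    and A: "A > 0" "mgf p = ennreal A" and B: "B > 0" "mgf q = ennreal B"
  shows "ln A + (\<Sum>i=1..k. w i * (q i - p i)) \<le> ln B"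
proof -
  define z where "z = restrict q {1..k}"
  have "z \<in> extensional {1..k}" by (simp add: z_def)
  hence "log_mgf k phi p + ereal (\<Sum>i=1..k. w i * (z i - p i)) \<le> log_mgf k phi z"
    using w unfolding subdifferential_def by blast
  moreover have "mgf z = ennreal B" unfolding z_def mgf_restrict by (rule B)
  moreover have "(\<Sum>i=1..k. w i * (z i - p i)) = (\<Sum>i=1..k. w i * (q i - p i))"
    unfolding z_def by (intro sum.cong) auto
  ultimately show ?thesis using log_mgf_finite[OF A] log_mgf_finite[OF B(1), of z] by simp
qed

text \<open>
  Since \<open>\<phi>\<^sub>k\<close> is positive, \<open>H\<close> is nondecreasing in the last variable. The infimum that defines \<open>g\<^sub>2\<close> is thus
  taken over a set that is bounded below.
\<close>

lemma subdifferential_last_nonneg: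
  assumes w: "w \<in> subdifferential k (log_mgf k phi) p"
  shows "w k \<ge> 0"
proof -
  define q where "q = p(k := p k - 1)"
  obtain A where A: "A > 0" "mgf p = ennreal A"
    using subdifferential_finite[OF w] by (rule mgf_finiteE)
  have le: "mgf q \<le> mgf p"
    unfolding mgf_def
  proof (rule nn_integral_mono)
    fix x assume "x \<in> space lam"
    hence "(\<Sum>i=1..k. q i * phi i x) \<le> (\<Sum>i=1..k. p i * phi i x)"
      using phi_pos by (intro sum_mono mult_right_mono) (auto simp: q_def less_imp_le)
    thus "ennreal (exp (\<Sum>i=1..k. q i * phi i x)) \<le> ennreal (exp (\<Sum>i=1..k. p i * phi i x))"
      by (intro ennreal_leI) simp
  qed
  hence "mgf q < \<infinity>" using A by (simp add: order.strict_trans1)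
  then obtain B where B: "B > 0" "mgf q = ennreal B" by (rule mgf_finiteE)
  have "B \<le> A" using le A B by (simp add: ennreal_le_iff)
  hence "ln B \<le> ln A" using A B by simp
  moreover have "(\<Sum>i=1..k. w i * (q i - p i)) = (\<Sum>i=1..k. if i = k then - w k else 0)"
    by (intro sum.cong) (auto simp: q_def)
  hence "(\<Sum>i=1..k. w i * (q i - p i)) = - w k" using index_bounds(2) by simp
  ultimately show ?thesis using subdifferential_le[OF w A B] by simp
qed

text \<open>
  Two parameters \<open>p\<close>, \<open>q\<close> of the same point make \<open>H\<close> affine between them: both subgradient inequalities at
  the midpoint add up to \<open>2 H((p+q)/2) \<ge> H(p) + H(q)\<close>. This is equality in the Cauchy--Schwarz inequality
  for \<open>e\<^bsup>p\<cdot>\<phi>/2\<^esup>\<close> and \<open>e\<^bsup>q\<cdot>\<phi>/2\<^esup>\<close>, so \<open>(p - q)\<cdot>\<phi>\<close> is almost everywhere constant.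
\<close>

lemma dual_param_unique:
  assumes p: "dual_param k phi v p" and q: "dual_param k phi v q"
  shows "p = q"
proof -
  obtain x where x: "x \<in> subdifferential k (log_mgf k phi) p" "v = restrict x {1..k-1}"
    using p unfolding dual_param_def by blast
  obtain y where y: "y \<in> subdifferential k (log_mgf k phi) q" "v = restrict y {1..k-1}"
    using q unfolding dual_param_def by blast
  have ext: "p \<in> extensional {1..k}" "q \<in> extensional {1..k}" and z: "p k = 0" "q k = 0"
    using p q by (auto simp: dual_param_def)
  obtain A where A: "A > 0" "mgf p = ennreal A"
    using subdifferential_finite[OF x(1)] by (rule mgf_finiteE)
  obtain B where B: "B > 0" "mgf q = ennreal B"
    using subdifferential_finite[OF y(1)] by (rule mgf_finiteE)
  define P where "P t = (\<Sum>i=1..k. p i * phi i t)" for t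
  define Q where "Q t = (\<Sum>i=1..k. q i * phi i t)" for t
  define m where "m i = (p i + q i) / 2" for i
  have mPQ: "(\<Sum>i=1..k. m i * phi i t) = P t / 2 + Q t / 2" for t
    unfolding P_def Q_def m_def by (simp add: sum.distrib[symmetric] sum_divide_distrib add_divide_distrib distrib_right)
  have Pm [measurable]: "P \<in> borel_measurable lam" unfolding P_def by (rule lin_measurable)
  have Qm [measurable]: "Q \<in> borel_measurable lam" unfolding Q_def by (rule lin_measurable)
  have PA: "has_bochner_integral lam (\<lambda>t. exp (P t)) A"
    using A unfolding mgf_def P_def[symmetric] by (intro has_bochner_integral_nn_integral) auto
  have QB: "has_bochner_integral lam (\<lambda>t. exp (Q t)) B"
    using B unfolding mgf_def Q_def[symmetric] by (intro has_bochner_integral_nn_integral) auto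
  define e where "e t = exp (P t / 2) * exp (Q t / 2)" for t
  have e_int: "integrable lam e"
  proof (rule Bochner_Integration.integrable_bound)
    show "integrable lam (\<lambda>t. exp (P t) + exp (Q t))"
      using PA QB by (auto simp: has_bochner_integral_iff)
    show "e \<in> borel_measurable lam" unfolding e_def by measurable
    show "AE t in lam. norm (e t) \<le> norm (exp (P t) + exp (Q t))"
    proof (rule AE_I2)
      fix t
      have "0 \<le> (exp (P t / 2) - exp (Q t / 2))\<^sup>2" by simp
      also have "\<dots> = (exp (P t / 2))\<^sup>2 + (exp (Q t / 2))\<^sup>2 - 2 * e t"
        by (simp only: power2_diff e_def mult.assoc)
      also have "\<dots> = exp (P t) + exp (Q t) - 2 * e t"
        by (simp only: power2_eq_square exp_add[symmetric]) simp
      finally have "2 * e t \<le> exp (P t) + exp (Q t)" by simp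
      moreover have "e t \<ge> 0" by (simp add: e_def)
      ultimately show "norm (e t) \<le> norm (exp (P t) + exp (Q t))" by (simp add: add_pos_pos)
    qed
  qed
  define D where "D = (\<integral>t. e t \<partial>lam)"
  have mD: "mgf m = ennreal D"
    unfolding mgf_def mPQ D_def using e_int
    by (subst nn_integral_eq_integral[symmetric]) (auto simp: e_def exp_add)
  have "D \<noteq> 0" using mD mgf_nonzero[of m] by auto
  moreover have "D \<ge> 0" unfolding D_def by (intro Bochner_Integration.integral_nonneg) (simp add: e_def)
  ultimately have D: "D > 0" by simp
  have sx: "(\<Sum>i=1..k. x i * (m i - p i)) = (\<Sum>i=1..k-1. v i * (q i - p i)) / 2"
  proof -
    have "{1..k} = insert k {1..k-1}" using k by auto
    hence "(\<Sum>i=1..k. x i * (m i - p i)) = (\<Sum>i\<in>insert k {1..k-1}. x i * (m i - p i))" by simp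
    also have "\<dots> = (\<Sum>i=1..k-1. x i * (m i - p i))"
      using k by (subst sum.insert) (auto simp: m_def z)
    also have "\<dots> = (\<Sum>i=1..k-1. v i * (q i - p i) / 2)"
      by (intro sum.cong) (auto simp: x(2) m_def field_simps)
    finally show ?thesis by (simp add: sum_divide_distrib)
  qed
  have sy: "(\<Sum>i=1..k. y i * (m i - q i)) = - (\<Sum>i=1..k-1. v i * (q i - p i)) / 2"
  proof -
    have "{1..k} = insert k {1..k-1}" using k by auto
    hence "(\<Sum>i=1..k. y i * (m i - q i)) = (\<Sum>i\<in>insert k {1..k-1}. y i * (m i - q i))" by simp
    also have "\<dots> = (\<Sum>i=1..k-1. y i * (m i - q i))"
      using k by (subst sum.insert) (auto simp: m_def z)
    also have "\<dots> = (\<Sum>i=1..k-1. - (v i * (q i - p i)) / 2)"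
      by (intro sum.cong) (auto simp: y(2) m_def field_simps)
    finally show ?thesis by (simp add: sum_divide_distrib sum_negf)
  qed
  have "ln A + ln B \<le> 2 * ln D"
    using subdifferential_le[OF x(1) A D mD] subdifferential_le[OF y(1) B D mD] unfolding sx sy by simp
  define a where "a = sqrt A"
  define b where "b = sqrt B"
  have ab: "a > 0" "b > 0" "a\<^sup>2 = A" "b\<^sup>2 = B" using A B by (auto simp: a_def b_def)
  have "ln (a * b) \<le> ln D"
  proof -
    have "ln A = 2 * ln a" "ln B = 2 * ln b" using ab by (auto simp: ln_realpow simp flip: ab(3,4))
    thus ?thesis using \<open>ln A + ln B \<le> 2 * ln D\<close> ab by (simp add: ln_mult)
  qed
  hence abD: "a * b \<le> D" using ab D by (subst (asm) ln_le_cancel_iff) auto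
  define s where "s t = (exp (P t / 2) / a - exp (Q t / 2) / b)\<^sup>2" for t
  have s_eq: "s t = exp (P t) / A + exp (Q t) / B - 2 * e t / (a * b)" for t
  proof -
    have "(exp (P t / 2))\<^sup>2 = exp (P t)" "(exp (Q t / 2))\<^sup>2 = exp (Q t)"
      by (simp_all add: power2_eq_square exp_add[symmetric])
    thus ?thesis by (simp add: s_def power2_diff power_divide ab e_def)
  qed
  have "has_bochner_integral lam s (A / A + B / B - 2 * D / (a * b))"
    unfolding s_eq D_def
    by (intro has_bochner_integral_diff has_bochner_integral_add has_bochner_integral_divide
          has_bochner_integral_mult_right PA QB has_bochner_integral_integrable e_int)
  moreover have "A / A + B / B - 2 * D / (a * b) \<le> 0"
    using A B ab abD by (simp add: field_simps)
  moreover have s0: "s t \<ge> 0" for t by (simp add: s_def)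
  ultimately have s_int: "integrable lam s" and "(\<integral>t. s t \<partial>lam) \<le> 0"
    by (auto simp: has_bochner_integral_iff)
  hence "(\<integral>t. s t \<partial>lam) = 0"
    using s0 by (intro antisym Bochner_Integration.integral_nonneg) auto
  hence "AE t in lam. s t = 0"
    using s_int s0 by (subst (asm) integral_nonneg_eq_0_iff_AE) auto
  hence "AE t in lam. (\<Sum>i=1..k. (p i - q i) * phi i t) = 2 * ln a - 2 * ln b"
  proof eventually_elim
    case (elim t)
    hence eq: "exp (P t / 2) / a = exp (Q t / 2) / b" by (simp add: s_def)
    have "P t / 2 - ln a = ln (exp (P t / 2) / a)" using ab by (simp add: ln_div)
    also have "\<dots> = Q t / 2 - ln b" unfolding eq using ab by (simp add: ln_div)
    finally have "P t - Q t = 2 * ln a - 2 * ln b" by simp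
    moreover have "(\<Sum>i=1..k. (p i - q i) * phi i t) = P t - Q t"
      by (simp add: P_def Q_def left_diff_distrib sum_subtractf)
    ultimately show ?case by simp
  qed
  hence "p i = q i" if "i \<in> {1..k}" for i
    using lin_nonconstant[of "\<lambda>i. p i - q i", OF _ that] by simp
  thus ?thesis by (rule extensionalityI[OF ext])
qed

text \<open>
  Suppose that \<open>q\<cdot>b - H(q) \<le> m\<close> for all \<open>q\<close>, where \<open>b = a - t e\<^sub>k\<close>. For \<open>q = p\<close> this and \<open>m \<le> p\<cdot>a - H(p)\<close> give
  \<open>p\<^sub>k t \<ge> 0\<close>, so \<open>p\<^sub>k = 0\<close> and \<open>m \<le> p\<cdot>b - H(p)\<close>. Inserting the latter into the supposition, \<open>b\<close> becomes a
  subgradient of \<open>H\<close> at \<open>p\<close>, and its last coordinate bounds \<open>g\<^sub>2\<close> from above.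
\<close>

lemma strict_improvement:
  assumes adm1: "restrict a {1..k-1} \<in> adm1 k phi"
    and p: "mgf p \<le> ennreal (exp ((\<Sum>i=1..k. p i * a i) - m))" and t: "t > 0"
    and no: "\<not> (restrict a {1..k-1} \<in> S1 k phi \<and> g2 k phi (restrict a {1..k-1}) \<le> a k - t)"
  obtains q A where "A > 0" "mgf q = ennreal A" "m < (\<Sum>i=1..k. q i * a i) - q k * t - ln A"
proof (rule ccontr)
  assume "\<not> thesis"
  hence all: "(\<Sum>i=1..k. q i * a i) - q k * t - ln A \<le> m" if "A > 0" "mgf q = ennreal A" for q A
    using that \<open>\<And>A q. A > 0 \<Longrightarrow> mgf q = ennreal A \<Longrightarrow> m < (\<Sum>i=1..k. q i * a i) - q k * t - ln A \<Longrightarrow> thesis\<close>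
    by (meson not_le)
  have fin: "mgf p < \<infinity>" using p by (rule order.strict_trans1) simp
  then obtain A where A: "A > 0" "mgf p = ennreal A" by (rule mgf_finiteE)
  have "A \<le> exp ((\<Sum>i=1..k. p i * a i) - m)" using p A by (simp add: ennreal_le_iff)
  hence "ln A \<le> (\<Sum>i=1..k. p i * a i) - m" using A by (metis exp_le_cancel_iff exp_ln)
  hence m_le: "m \<le> (\<Sum>i=1..k. p i * a i) - ln A" by simp
  have "0 \<le> p k * t" using all[OF A] m_le by linarith
  hence "p k \<ge> 0" using t by (simp add: zero_le_mult_iff)
  hence pk: "p k = 0" using mgf_finite_imp_nonpos[OF fin] by simp
  define b where "b = restrict (a(k := a k - t)) {1..k}"
  have qb: "(\<Sum>i=1..k. q i * b i) = (\<Sum>i=1..k. q i * a i) - q k * t" for q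
  proof -
    have "(\<Sum>i=1..k. q i * b i) = (\<Sum>i=1..k. q i * a i - (if i = k then q k * t else 0))"
      by (intro sum.cong) (auto simp: b_def algebra_simps)
    thus ?thesis using index_bounds(2) by (simp add: sum_subtractf)
  qed
  define p' where "p' = restrict p {1..k}"
  have Ap': "mgf p' = ennreal A" unfolding p'_def mgf_restrict by (rule A)
  have sub: "b \<in> subdifferential k (log_mgf k phi) p'"
    unfolding subdifferential_def
  proof (safe)
    show "b \<in> extensional {1..k}" by (simp add: b_def)
    fix q :: "nat \<Rightarrow> real"
    show "log_mgf k phi p' + ereal (\<Sum>i=1..k. b i * (q i - p' i)) \<le> log_mgf k phi q"
    proof (cases "mgf q < \<infinity>")
      case True
      then obtain B where B: "B > 0" "mgf q = ennreal B" by (rule mgf_finiteE)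
      have "(\<Sum>i=1..k. b i * (q i - p' i)) = (\<Sum>i=1..k. q i * b i - p i * b i)"
        by (intro sum.cong) (auto simp: p'_def algebra_simps)
      also have "\<dots> = (\<Sum>i=1..k. q i * b i) - (\<Sum>i=1..k. p i * b i)" by (rule sum_subtractf)
      also have "\<dots> = (\<Sum>i=1..k. q i * a i) - q k * t - (\<Sum>i=1..k. p i * a i)"
        unfolding qb by (simp add: pk)
      finally have "ln A + (\<Sum>i=1..k. b i * (q i - p' i)) \<le> ln B"
        using all[OF B] m_le by linarith
      thus ?thesis using log_mgf_finite[OF A(1) Ap'] log_mgf_finite[OF B] by simp
    next
      case False
      hence "log_mgf k phi q = \<infinity>" by (simp add: log_mgf_eq elog_def not_less top_unique)
      thus ?thesis by simp
    qed
  qed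
  have "restrict a {1..k-1} = restrict b {1..k-1}" by (auto simp: b_def restrict_def fun_eq_iff)
  hence dual: "dual_param k phi (restrict a {1..k-1}) p'"
    unfolding dual_param_def using sub index_bounds(2) pk by (auto simp: p'_def)
  hence "restrict a {1..k-1} \<in> S1 k phi" using adm1 by (auto simp: S1_def)
  moreover have "g2 k phi (restrict a {1..k-1}) \<le> a k - t"
  proof -
    have "(THE p. dual_param k phi (restrict a {1..k-1}) p) = p'"
      using dual dual_param_unique by (intro the_equality) auto
    hence "g2 k phi (restrict a {1..k-1}) = Inf ((\<lambda>w. w k) ` subdifferential k (log_mgf k phi) p')"
      by (simp add: g2_def)
    also have "\<dots> \<le> b k"
      by (intro cInf_lower imageI sub bdd_belowI2[where m = 0] subdifferential_last_nonneg)
    also have "b k = a k - t" using index_bounds(2) by (simp add: b_def)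
    finally show ?thesis .
  qed
  ultimately show False using no by blast
qed

end

section \<open>Exponential cost of a large term\<close>

context constraint_functions begin

abbreviation "prodm n \<equiv> PiM {..<n::nat} (\<lambda>_. lam)"

text \<open>
  One observation that respects the constraint on \<open>\<phi>\<^sub>k\<close> has no influence on the averages of the other
  functions: far out by the growth gap, and elsewhere because the monotone functions are bounded on each \<open>(0,R]\<close>.
\<close>

lemma lower_terms_negligible:
  assumes "\<delta> > 0"
  shows "\<forall>\<^sub>F n in sequentially. \<forall>y>0. phi k y \<le> real n * c \<longrightarrow> (\<forall>i\<in>{1..k-1}. phi i y \<le> real n * \<delta>)"
proof -
  define C where "C = \<bar>c\<bar> + 1"
  have C: "C > 0" "c \<le> C" by (auto simp: C_def)
  have "\<forall>\<^sub>F x in at_top. \<forall>i\<in>{1..k-1}. phi i x / phi k x < \<delta> / C"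
    using \<open>\<delta> > 0\<close> C k by (intro eventually_ball_finite ballI order_tendstoD(2)[OF phi_ratio_tendsto]) auto
  then obtain R0 where R0: "\<forall>x\<ge>R0. \<forall>i\<in>{1..k-1}. phi i x / phi k x < \<delta> / C"
    unfolding eventually_at_top_linorder by blast
  define R where "R = max R0 1"
  have R: "R > 0" "R \<ge> R0" by (auto simp: R_def)
  define K where "K = (\<Sum>i=1..k-1. phi i R)"
  have "\<forall>\<^sub>F n in sequentially. K / \<delta> \<le> real n" using filterlim_real_sequentially unfolding filterlim_at_top by blast
  thus ?thesis
  proof eventually_elim
    case (elim n)
    show ?case
    proof (intro allI impI ballI)
      fix y i assume y: "y > 0" "phi k y \<le> real n * c" and i: "i \<in> {1..k-1}"
      hence ik: "i \<in> {1..k}" by auto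
      show "phi i y \<le> real n * \<delta>"
      proof (cases "y \<ge> R")
        case True
        hence "phi i y / phi k y < \<delta> / C" using R0 R i by auto
        hence "phi i y < \<delta> / C * phi k y" using phi_pos[OF index_bounds(2) y(1)] by (simp add: divide_less_eq)
        also have "\<dots> \<le> \<delta> / C * (real n * C)"
          using y(2) C \<open>\<delta> > 0\<close> by (intro mult_left_mono order.trans[OF y(2)]) auto
        also have "\<dots> = real n * \<delta>" using C by simp
        finally show ?thesis by simp
      next
        case False
        have "phi i y \<le> phi i R" using y R False ik by (intro mono_onD[OF phi_mono]) auto
        also have "\<dots> \<le> K"
          unfolding K_def using i phi_pos R by (intro member_le_sum) (auto intro!: less_imp_le)
        also have "K \<le> real n * \<delta>" using elim \<open>\<delta> > 0\<close> by (simp add: field_simps)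
        finally show ?thesis .
      qed
    qed
  qed
qed

definition large_term :: "real \<Rightarrow> nat \<Rightarrow> (nat \<Rightarrow> real) \<Rightarrow> bool" where
  "large_term t n x \<longleftrightarrow> (\<exists>j<n. t \<le> phi k (x j) / real n)"

lemma constraint_event_sets: "{x\<in>space (prodm n). constraint_event k phi a n \<delta> x} \<in> sets (prodm n)"
  unfolding constraint_event_def emp_mean_def
  by (intro sets.sets_Collect_finite_All borel_measurable_le borel_measurable_abs
        borel_measurable_diff borel_measurable_average borel_measurable_const phi_measurable finite_atLeastAtMost)

lemma large_term_sets: "{x\<in>space (prodm n). large_term t n x} \<in> sets (prodm n)"
proof -
  have "{x\<in>space (prodm n). large_term t n x} = {x\<in>space (prodm n). \<exists>j\<in>{..<n}. t \<le> phi k (x j) / real n}"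
    by (auto simp: large_term_def)
  also have "\<dots> \<in> sets (prodm n)"
  proof (intro sets.sets_Collect_finite_Ex borel_measurable_le borel_measurable_const borel_measurable_divide)
    fix j assume "j \<in> {..<n}"
    thus "(\<lambda>x. phi k (x j)) \<in> borel_measurable (prodm n)"
      using phi_measurable[OF index_bounds(2)] by (intro measurable_compose[OF measurable_component_singleton])
  qed simp
  finally show ?thesis .
qed

text \<open>
  A union bound over the index \<open>j\<close> of the large term, followed by the exponential Markov inequality for
  the other terms. The sign \<open>q\<^sub>k \<le> 0\<close> is what turns the upper bound on the last moment of the other
  terms into a lower bound on their weighted sum.
\<close>

lemma large_term_probability_bound:
  fixes a q :: "nat \<Rightarrow> real" and t \<delta> A :: real
  assumes q: "mgf q = ennreal A" "A > 0" and "\<delta> > 0"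
  defines "s \<equiv> (\<Sum>i=1..k. q i * a i) - q k * t - 2 * \<delta> * (\<Sum>i=1..k. \<bar>q i\<bar>)"
  shows "\<forall>\<^sub>F n in sequentially. measure (prodm n) {x\<in>space (prodm n). large_term t n x \<and> constraint_event k phi a n \<delta> x}
      \<le> real n * (A ^ (n - 1) * exp (- (real n * s)))"
  using lower_terms_negligible[OF \<open>\<delta> > 0\<close>, of "a k + \<delta>"] eventually_gt_at_top[of 0]
proof eventually_elim
  case (elim n)
  define F where "F y = (\<Sum>i=1..k. q i * phi i y)" for y
  have qk: "q k \<le> 0" using q by (intro mgf_finite_imp_nonpos) simp
  interpret P: product_prob_space "\<lambda>_. lam" "{..<n}" by (rule N.product_prob_space_const)
  define E where "E j = {x\<in>space (prodm n). real n * s \<le> (\<Sum>l\<in>{..<n} - {j}. F (x l))}" for j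
  have mgf_F: "(\<integral>\<^sup>+y. ennreal (exp (F y)) \<partial>lam) = ennreal A" using q(1) unfolding mgf_def F_def .
  have Fm: "F \<in> borel_measurable lam" unfolding F_def by (rule lin_measurable)
  have Em: "E j \<in> sets (prodm n)" for j
    unfolding E_def
  proof (intro borel_measurable_le borel_measurable_const borel_measurable_sum)
    fix l assume "l \<in> {..<n} - {j}"
    thus "(\<lambda>x. F (x l)) \<in> borel_measurable (prodm n)"
      using Fm by (intro measurable_compose[OF measurable_component_singleton]) auto
  qed
  have sub: "{x\<in>space (prodm n). large_term t n x \<and> constraint_event k phi a n \<delta> x} \<subseteq> (\<Union>j<n. E j)"
  proof safe
    fix x assume x: "x \<in> space (prodm n)" "large_term t n x" and c: "constraint_event k phi a n \<delta> x"
    from x(2) obtain j where j: "j < n" "t \<le> phi k (x j) / real n" by (auto simp: large_term_def)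
    have pos: "x l > 0" if "l < n" for l using x that by (auto simp: space_PiM PiE_iff)
    have n: "real n > 0" using elim by simp
    have S: "\<bar>(\<Sum>l<n. phi i (x l)) - real n * a i\<bar> \<le> real n * \<delta>" if "i \<in> {1..k}" for i
    proof -
      have "\<bar>(\<Sum>l<n. phi i (x l)) / real n - a i\<bar> \<le> \<delta>" using c that by (simp add: constraint_event_def emp_mean_def)
      hence "real n * \<bar>(\<Sum>l<n. phi i (x l)) / real n - a i\<bar> \<le> real n * \<delta>"
        using n by (intro mult_left_mono) auto
      also have "real n * \<bar>(\<Sum>l<n. phi i (x l)) / real n - a i\<bar> = \<bar>real n * ((\<Sum>l<n. phi i (x l)) / real n - a i)\<bar>"
        by (simp add: abs_mult)
      also have "real n * ((\<Sum>l<n. phi i (x l)) / real n - a i) = (\<Sum>l<n. phi i (x l)) - real n * a i"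
        using n by (simp add: right_diff_distrib)
      finally show ?thesis .
    qed
    define T where "T i = (\<Sum>l\<in>{..<n} - {j}. phi i (x l))" for i
    have T: "(\<Sum>l<n. phi i (x l)) = phi i (x j) + T i" for i
      unfolding T_def using j by (intro sum.remove) auto
    have T0: "T i \<ge> 0" if "i \<in> {1..k}" for i
      unfolding T_def using pos phi_pos[OF that] by (intro sum_nonneg) (auto intro: less_imp_le)
    have "phi k (x j) \<le> real n * (a k + \<delta>)"
      using S[OF index_bounds(2)] T[of k] T0[OF index_bounds(2)] by (simp add: distrib_left abs_le_iff)
    hence small: "phi i (x j) \<le> real n * \<delta>" if "i \<in> {1..k-1}" for i
      using elim(1) pos[OF j(1)] that by blast
    \<comment> \<open>Each coordinate of the remaining sum, up to the error \<open>2 n \<delta> \<bar>q\<^sub>i\<bar>\<close>.\<close>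
    have coord: "real n * (q i * a i - (if i = k then q k * t else 0) - 2 * \<delta> * \<bar>q i\<bar>) \<le> q i * T i"
      if i: "i \<in> {1..k}" for i
    proof (cases "i = k")
      case True
      have "real n * t \<le> phi k (x j)" using j(2) n by (simp add: field_simps)
      hence "T k \<le> real n * (a k - t + \<delta>)"
        using S[OF index_bounds(2)] T[of k] by (simp add: algebra_simps abs_le_iff)
      hence "q k * (real n * (a k - t + \<delta>)) \<le> q k * T k" using qk by (rule mult_left_mono_neg)
      moreover have "real n * (q k * a k - q k * t - 2 * \<delta> * \<bar>q k\<bar>) \<le> q k * (real n * (a k - t + \<delta>))"
      proof -
        have "q k * \<delta> \<ge> - (2 * \<delta> * \<bar>q k\<bar>)" using qk \<open>\<delta> > 0\<close> by (simp add: mult_nonneg_nonpos2)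
        hence "q k * a k - q k * t - 2 * \<delta> * \<bar>q k\<bar> \<le> q k * (a k - t + \<delta>)" by (simp add: algebra_simps)
        hence "real n * (q k * a k - q k * t - 2 * \<delta> * \<bar>q k\<bar>) \<le> real n * (q k * (a k - t + \<delta>))"
          using n by (intro mult_left_mono) auto
        thus ?thesis by (simp only: mult.left_commute)
      qed
      ultimately show ?thesis using True by simp
    next
      case False
      hence i': "i \<in> {1..k-1}" using i by auto
      have "phi i (x j) > 0" using phi_pos[OF i] pos[OF j(1)] by simp
      hence "\<bar>T i - real n * a i\<bar> \<le> 2 * (real n * \<delta>)"
        using S[OF i] small[OF i'] T[of i] by linarith
      hence "\<bar>q i * (T i - real n * a i)\<bar> \<le> \<bar>q i\<bar> * (2 * (real n * \<delta>))"
        unfolding abs_mult by (intro mult_left_mono) auto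
      hence "- (\<bar>q i\<bar> * (2 * (real n * \<delta>))) \<le> q i * (T i - real n * a i)" by linarith
      thus ?thesis using False by (simp add: algebra_simps)
    qed
    have "real n * s = (\<Sum>i=1..k. real n * (q i * a i - (if i = k then q k * t else 0) - 2 * \<delta> * \<bar>q i\<bar>))"
      unfolding s_def sum_distrib_left[symmetric] using index_bounds(2)
      by (simp add: sum_subtractf sum_distrib_left[symmetric])
    also have "\<dots> \<le> (\<Sum>i=1..k. q i * T i)" using coord by (intro sum_mono) auto
    also have "\<dots> = (\<Sum>l\<in>{..<n} - {j}. F (x l))"
      unfolding T_def F_def sum_distrib_left by (rule sum.swap)
    finally show "x \<in> (\<Union>j<n. E j)" using x j by (auto simp: E_def)
  qed
  have "P.prob {x\<in>space (prodm n). large_term t n x \<and> constraint_event k phi a n \<delta> x} \<le> P.prob (\<Union>j<n. E j)"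
    using sub Em by (intro P.finite_measure_mono) auto
  also have "\<dots> \<le> (\<Sum>j<n. P.prob (E j))"
    using Em by (intro P.finite_measure_subadditive_finite) auto
  also have "\<dots> \<le> (\<Sum>j<n. A ^ (n - 1) * exp (- (real n * s)))"
  proof (intro sum_mono)
    fix j assume "j \<in> {..<n}"
    thus "P.prob (E j) \<le> A ^ (n - 1) * exp (- (real n * s))"
      unfolding E_def using q Fm
      by (intro N.chernoff_bound_omitting_one) (auto simp: mgf_F)
  qed
  finally show ?case by simp
qed

text \<open>
  The gap \<open>d = q\<cdot>b - H(q) - m\<close> is spent as follows: a quarter on the entropy of the chosen density being
  larger than \<open>m\<close>, a quarter on the deviation in the change of measure, a quarter on the error
  \<open>2 \<delta> \<Sum>\<bar>q\<^sub>i\<bar>\<close>, and half of the remaining quarter on the polynomial factor \<open>2 n / A\<close>.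
\<close>

lemma exponential_tail:
  assumes a: "a \<in> adm k phi"
    and cont: "continuous_map (subtopology (powertop_real {1..k-1}) (adm1 k phi))
                    euclideanreal (g1 k phi)"
    and t: "t > 0"
    and no: "\<not> (restrict a {1..k-1} \<in> S1 k phi \<and> g2 k phi (restrict a {1..k-1}) \<le> a k - t)"
  obtains c \<delta>0 where "c > 0" "\<delta>0 > 0"
    "\<And>\<delta>. 0 < \<delta> \<Longrightarrow> \<delta> < \<delta>0 \<Longrightarrow> \<forall>\<^sub>F n in sequentially.
        0 < measure (prodm n) {x\<in>space (prodm n). constraint_event k phi a n \<delta> x} \<and>
        measure (prodm n) {x\<in>space (prodm n). large_term t n x \<and> constraint_event k phi a n \<delta> x}
        \<le> exp (- c * real n) * measure (prodm n) {x\<in>space (prodm n). constraint_event k phi a n \<delta> x}"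
proof -
  obtain \<rho> where box: "\<rho> > 0" "\<And>v. (\<forall>i\<in>{1..k}. \<bar>v i - a i\<bar> < \<rho>) \<Longrightarrow> \<exists>r. att v r"
    using admissible_box[OF a cont] by blast
  obtain m p where m: "\<And>\<eta>. \<eta> > 0 \<Longrightarrow> \<exists>r<m+\<eta>. att a r"
    and p: "mgf p \<le> ennreal (exp ((\<Sum>i=1..k. p i * a i) - m))"
    using supporting_parameter[OF box] by blast
  have "restrict a {1..k-1} \<in> adm1 k phi" using a by (simp add: adm_def)
  from strict_improvement[OF this p t no] obtain q A where A: "A > 0" "mgf q = ennreal A"
    and gap: "m < (\<Sum>i=1..k. q i * a i) - q k * t - ln A" by blast
  define d where "d = (\<Sum>i=1..k. q i * a i) - q k * t - ln A - m"
  have d: "d > 0" using gap by (simp add: d_def)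
  define S where "S = (\<Sum>i=1..k. \<bar>q i\<bar>)"
  have S: "S \<ge> 0" unfolding S_def by (intro sum_nonneg) auto
  define \<delta>0 where "\<delta>0 = d / (8 * (S + 1))"
  obtain r where r: "r < m + d / 4" "att a r" using m[of "d/4"] d by auto
  show ?thesis
  proof (rule that[of "d / 8" \<delta>0])
    show "d / 8 > 0" "\<delta>0 > 0" using d S by (auto simp: \<delta>0_def)
    fix \<delta> assume \<delta>: "0 < \<delta>" "\<delta> < \<delta>0"
    have "2 * \<delta> * S \<le> 2 * \<delta>0 * (S + 1)" using \<delta> S by (intro mult_mono) auto
    also have "\<dots> = d / 4" using S by (simp add: \<delta>0_def field_simps)
    finally have \<delta>S: "2 * \<delta> * S \<le> d / 4" .
    define s where "s = (\<Sum>i=1..k. q i * a i) - q k * t - 2 * \<delta> * S"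
    have "s = m + d + ln A - 2 * \<delta> * S" by (simp add: s_def d_def)
    hence s: "s - ln A \<ge> m + 3 * d / 4" using \<delta>S by linarith
    have "(\<lambda>n. 2 * real n / A * exp (- (d / 8) * real n)) \<longlonglongrightarrow> 0"
      using d A by real_asymp
    hence ev: "\<forall>\<^sub>F n in sequentially. 2 * real n / A * exp (- (d / 8) * real n) < 1"
      by (rule order_tendstoD) simp
    have low: "\<forall>\<^sub>F n in sequentially. exp (- (r + d / 4) * real n) / 2 \<le>
        measure (prodm n) {x\<in>space (prodm n). constraint_event k phi a n \<delta> x}"
      unfolding constraint_event_def emp_mean_def using d \<delta> by (intro N.entropy_lower_bound phi_measurable r) auto
    have up: "\<forall>\<^sub>F n in sequentially. measure (prodm n) {x\<in>space (prodm n). large_term t n x \<and> constraint_event k phi a n \<delta> x}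
        \<le> real n * (A ^ (n - 1) * exp (- (real n * s)))"
      unfolding s_def S_def using A \<delta> by (intro large_term_probability_bound) auto
    show "\<forall>\<^sub>F n in sequentially.
        0 < measure (prodm n) {x\<in>space (prodm n). constraint_event k phi a n \<delta> x} \<and>
        measure (prodm n) {x\<in>space (prodm n). large_term t n x \<and> constraint_event k phi a n \<delta> x}
        \<le> exp (- (d / 8) * real n) * measure (prodm n) {x\<in>space (prodm n). constraint_event k phi a n \<delta> x}"
      using ev low up eventually_gt_at_top[of 0]
    proof eventually_elim
      case (elim n)
      let ?C = "measure (prodm n) {x\<in>space (prodm n). constraint_event k phi a n \<delta> x}"
      have n: "real n > 0" using elim by simp
      have An: "A ^ (n - 1) = exp (real n * ln A) / A"
      proof -
        have "A ^ n = exp (real n * ln A)" using A by (simp add: exp_of_nat_mult)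
        moreover have "A ^ n = A * A ^ (n - 1)" using elim by (cases n) auto
        ultimately show ?thesis using A by (simp add: field_simps)
      qed
      have Cl: "exp (- (m + d / 2) * real n) / 2 \<le> ?C"
      proof -
        have "- (m + d / 2) * real n \<le> - (r + d / 4) * real n" using r n by (intro mult_right_mono) auto
        thus ?thesis using elim(2) by (smt (verit) divide_right_mono exp_le_cancel_iff)
      qed
      hence "?C > 0" by (rule order.strict_trans2[rotated]) simp
      moreover have "measure (prodm n) {x\<in>space (prodm n). large_term t n x \<and> constraint_event k phi a n \<delta> x}
          \<le> exp (- (d / 8) * real n) * ?C"
      proof -
        have "real n * (A ^ (n - 1) * exp (- (real n * s))) = real n / A * exp (- (s - ln A) * real n)"
          unfolding An by (simp add: exp_add[symmetric] algebra_simps)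
        also have "\<dots> \<le> real n / A * exp (- (m + 3 * d / 4) * real n)"
          using s n A by (intro mult_left_mono) (auto intro!: mult_right_mono)
        also have "- (m + 3 * d / 4) * real n
            = - (d / 8) * real n + (- (d / 8) * real n + - (m + d / 2) * real n)"
          by (simp add: field_simps)
        also have "real n / A * exp (- (d / 8) * real n + (- (d / 8) * real n + - (m + d / 2) * real n))
            = (2 * real n / A * exp (- (d / 8) * real n)) *
              (exp (- (d / 8) * real n) * (exp (- (m + d / 2) * real n) / 2))"
        proof -
          have "x / A * (e * (e * f)) = (2 * x / A * e) * (e * (f / 2))" for x e f :: real by simp
          thus ?thesis unfolding exp_add .
        qed
        also have "\<dots> \<le> 1 * (exp (- (d / 8) * real n) * ?C)"
          using elim(1) Cl A n by (intro mult_mono) auto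
        finally show ?thesis using elim(3) by simp
      qed
      ultimately show ?case by simp
    qed
  qed
qed

end

section \<open>Conditional tail estimates\<close>

context constraint_functions begin

lemma max_term_ge_iff: "n > 0 \<Longrightarrow> t \<le> max_term k phi n x \<longleftrightarrow> large_term t n x"
  unfolding max_term_def large_term_def by (subst Max_ge_iff) (auto simp: lessThan_empty_iff)

lemma constraint_event_restrict: "constraint_event k phi a n \<delta> (restrict x {..<n}) = constraint_event k phi a n \<delta> x"
  by (simp add: constraint_event_def emp_mean_def)

lemma large_term_restrict: "large_term t n (restrict x {..<n}) = large_term t n x"
  by (auto simp: large_term_def)

lemma conditional_tail_bounds:
  assumes C_pos: "0 < measure (prodm n) {x\<in>space (prodm n). constraint_event k phi a n \<delta> x}"
    and le: "measure (prodm n) {x\<in>space (prodm n). large_term t n x \<and> constraint_event k phi a n \<delta> x}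
        \<le> e * measure (prodm n) {x\<in>space (prodm n). constraint_event k phi a n \<delta> x}"
    and n: "n > 0"
  shows "\<P>(\<omega> in sample_measure phi. max_term k phi n \<omega> \<ge> t \<bar> constraint_event k phi a n \<delta> \<omega>) \<le> e"
    and "1 - e \<le> lower_prob k phi a t \<delta> n"
    and "lower_prob k phi a t \<delta> n \<le> 1"
proof -
  have S: "sample_measure phi = PiM UNIV (\<lambda>_. lam)" by (simp add: sample_measure_def)
  let ?U = "PiM (UNIV :: nat set) (\<lambda>_. lam)"
  interpret P: product_prob_space "\<lambda>_. lam" "UNIV :: nat set" by (rule N.product_prob_space_const)
  have bc_sets: "{x\<in>space (prodm n). large_term t n x \<and> constraint_event k phi a n \<delta> x} \<in> sets (prodm n)"
    by (intro sets.sets_Collect_conj large_term_sets constraint_event_sets)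
  have C: "{x\<in>space ?U. constraint_event k phi a n \<delta> x} \<in> sets ?U"
    "P.prob {x\<in>space ?U. constraint_event k phi a n \<delta> x} = measure (prodm n) {x\<in>space (prodm n). constraint_event k phi a n \<delta> x}"
    by (rule N.PiM_restrict_event[OF finite_lessThan constraint_event_restrict constraint_event_sets])+
  have BC: "{x\<in>space ?U. large_term t n x \<and> constraint_event k phi a n \<delta> x} \<in> sets ?U"
    "P.prob {x\<in>space ?U. large_term t n x \<and> constraint_event k phi a n \<delta> x}
      = measure (prodm n) {x\<in>space (prodm n). large_term t n x \<and> constraint_event k phi a n \<delta> x}"
    by (rule N.PiM_restrict_event[OF finite_lessThan _ bc_sets], simp add: constraint_event_restrict large_term_restrict)+
  define c where "c = P.prob {x\<in>space ?U. constraint_event k phi a n \<delta> x}"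
  define b where "b = P.prob {x\<in>space ?U. large_term t n x \<and> constraint_event k phi a n \<delta> x}"
  have c0: "c > 0" and bc: "b \<le> e * c" and b0: "b \<ge> 0"
    using C_pos le C(2) BC(2) by (auto simp: c_def b_def)
  have "\<P>(\<omega> in sample_measure phi. max_term k phi n \<omega> \<ge> t \<bar> constraint_event k phi a n \<delta> \<omega>) = b / c"
    unfolding cond_prob_def S max_term_ge_iff[OF n] b_def c_def ..
  thus "\<P>(\<omega> in sample_measure phi. max_term k phi n \<omega> \<ge> t \<bar> constraint_event k phi a n \<delta> \<omega>) \<le> e"
    using c0 bc by (simp add: divide_le_eq)
  have "{x\<in>space ?U. max_term k phi n x < t \<and> constraint_event k phi a n \<delta> x}
      = {x\<in>space ?U. constraint_event k phi a n \<delta> x} - {x\<in>space ?U. large_term t n x \<and> constraint_event k phi a n \<delta> x}"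
    using max_term_ge_iff[OF n, of t] by (auto simp: not_le[symmetric])
  hence "P.prob {x\<in>space ?U. max_term k phi n x < t \<and> constraint_event k phi a n \<delta> x} = c - b"
    unfolding c_def b_def using C(1) BC(1) by (simp only:) (rule P.finite_measure_Diff, auto)
  hence lower: "lower_prob k phi a t \<delta> n = (c - b) / c"
    unfolding lower_prob_def cond_prob_def S c_def by simp
  show "1 - e \<le> lower_prob k phi a t \<delta> n" "lower_prob k phi a t \<delta> n \<le> 1"
    unfolding lower using c0 bc b0 by (auto simp: divide_le_eq le_divide_eq algebra_simps)
qed

text \<open>
  An exponential bound on the conditional probability that holds for all small \<open>\<delta>\<close> with the same rate
  survives both upper limits. It also forces the complementary probabilities to tend to \<open>1\<close> for each
  small \<open>\<delta>\<close>.
\<close>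

lemma tail_conclusions:
  assumes a: "a \<in> adm k phi"
    and cont: "continuous_map (subtopology (powertop_real {1..k-1}) (adm1 k phi))
                    euclideanreal (g1 k phi)"
    and t: "t > 0"
    and no: "\<not> (restrict a {1..k-1} \<in> S1 k phi \<and> g2 k phi (restrict a {1..k-1}) \<le> a k - t)"
  shows "upper_tail_rate k phi a t < 0"
    and "\<forall>\<^sub>F \<delta> in at_right 0. lower_prob k phi a t \<delta> \<longlonglongrightarrow> 1"
proof -
  obtain c \<delta>0 where c: "c > 0" "\<delta>0 > 0" and main:
    "\<And>\<delta>. 0 < \<delta> \<Longrightarrow> \<delta> < \<delta>0 \<Longrightarrow> \<forall>\<^sub>F n in sequentially.
        0 < measure (prodm n) {x\<in>space (prodm n). constraint_event k phi a n \<delta> x} \<and>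
        measure (prodm n) {x\<in>space (prodm n). large_term t n x \<and> constraint_event k phi a n \<delta> x}
        \<le> exp (- c * real n) * measure (prodm n) {x\<in>space (prodm n). constraint_event k phi a n \<delta> x}"
    using exponential_tail[OF a cont t no] by blast
  have \<delta>_ev: "\<forall>\<^sub>F \<delta> in at_right 0. 0 < \<delta> \<and> \<delta> < \<delta>0"
    using c(2) eventually_at_right_real[of 0 \<delta>0] by (auto elim: eventually_mono)
  show "upper_tail_rate k phi a t < 0"
  proof -
    have "upper_tail_rate k phi a t \<le> ereal (- c)"
      unfolding upper_tail_rate_def
    proof (rule Limsup_bounded)
      show "\<forall>\<^sub>F \<delta> in at_right 0. limsup (\<lambda>n. ereal (1 / real n) *
         elog (ennreal (\<P>(\<omega> in sample_measure phi. t \<le> max_term k phi n \<omega> \<bar> constraint_event k phi a n \<delta> \<omega>))))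
         \<le> ereal (- c)"
        using \<delta>_ev
      proof eventually_elim
        case (elim \<delta>)
        show ?case
        proof (rule Limsup_bounded)
          show "\<forall>\<^sub>F n in sequentially. ereal (1 / real n) *
             elog (ennreal (\<P>(\<omega> in sample_measure phi. t \<le> max_term k phi n \<omega> \<bar> constraint_event k phi a n \<delta> \<omega>)))
             \<le> ereal (- c)"
            using main[OF conjunct1[OF elim] conjunct2[OF elim]] eventually_gt_at_top[of 0]
          proof eventually_elim
            case (elim n)
            let ?p = "\<P>(\<omega> in sample_measure phi. t \<le> max_term k phi n \<omega> \<bar> constraint_event k phi a n \<delta> \<omega>)"
            have p: "?p \<le> exp (- c * real n)"
              using elim by (intro conditional_tail_bounds(1)) auto
            have n: "1 / real n > 0" using elim by simp
            show ?case
            proof (cases "?p > 0")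
              case True
              hence e: "elog (ennreal ?p) = ereal (ln ?p)" by (simp add: elog_def)
              have "ln ?p \<le> ln (exp (- c * real n))" using p True by (subst ln_le_cancel_iff) auto
              hence "ln ?p \<le> - c * real n" by simp
              hence "1 / real n * ln ?p \<le> 1 / real n * (- c * real n)" using n by (intro mult_left_mono) auto
              also have "\<dots> = - c" using n by simp
              finally show ?thesis unfolding e by simp
            next
              case False
              hence "elog (ennreal ?p) = - \<infinity>" by (simp add: elog_def ennreal_eq_0_iff)
              thus ?thesis using n by simp
            qed
          qed
        qed
      qed
    qed
    also have "\<dots> < 0" using c by simp
    finally show ?thesis .
  qed
  show "\<forall>\<^sub>F \<delta> in at_right 0. lower_prob k phi a t \<delta> \<longlonglongrightarrow> 1"
    using \<delta>_ev
  proof eventually_elim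
    case (elim \<delta>)
    have ev: "\<forall>\<^sub>F n in sequentially. 1 - exp (- c * real n) \<le> lower_prob k phi a t \<delta> n \<and>
        lower_prob k phi a t \<delta> n \<le> 1"
      using main[OF conjunct1[OF elim] conjunct2[OF elim]] eventually_gt_at_top[of 0]
    proof eventually_elim
      case (elim n)
      thus ?case using conditional_tail_bounds(2,3)[of n a \<delta> t "exp (- c * real n)"] by simp
    qed
    have lim: "(\<lambda>n. 1 - exp (- c * real n)) \<longlonglongrightarrow> 1" using c by real_asymp
    show ?case
      by (rule tendsto_sandwich[OF _ _ lim tendsto_const]) (use ev in \<open>auto elim: eventually_mono\<close>)
  qed
qed

end

theorem theorem2p5:
  fixes k :: nat and phi :: "nat \<Rightarrow> real \<Rightarrow> real" and a :: "nat \<Rightarrow> real" and \<epsilon> :: real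
  assumes k: "k \<ge> 2"
    and phi_pos: "\<forall>i\<in>{1..k}. \<forall>x>0. phi i x > 0"
    and C1: "\<forall>i\<in>{1..k}. phi i C1_differentiable_on {0<..} \<and> mono_on {0<..} (phi i) \<and>
               filterlim (phi i) at_top at_top"
    and C2: "\<forall>i\<in>{1..k}. \<forall>c>0. (\<integral>\<^sup>+ x. ennreal (exp (- c * phi i x)) \<partial>pos_lborel) < \<infinity>"
    and C3: "\<exists>\<kappa>>1. \<forall>i\<in>{1..k-1}. \<forall>\<^sub>F x in at_top. phi i x powr \<kappa> < phi (i + 1) x"
    and C4: "\<exists>C>0. \<exists>M>0. \<forall>i\<in>{1..k}. \<forall>x>C.
               1 / C * phi i x powr (- M) < deriv (phi i) x \<and> deriv (phi i) x < C * phi i x powr M"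
    and g1_cont: "continuous_map (subtopology (powertop_real {1..k-1}) (adm1 k phi))
                    euclideanreal (g1 k phi)"
    and a: "a \<in> adm k phi"
    and eps: "\<epsilon> > 0"
  shows
    "(let a' = restrict a {1..k-1} in
       (a' \<in> S2 k phi \<or> (a' \<in> S1 k phi \<and> a k \<le> g2 k phi a') \<longrightarrow>
          upper_tail_rate k phi a \<epsilon> < 0 \<and>
          (\<exists>L. (\<forall>\<^sub>F \<delta> in at_right 0. lower_prob k phi a \<epsilon> \<delta> \<longlonglongrightarrow> L \<delta>) \<and>
               (L \<longlongrightarrow> 1) (at_right 0))) \<and>
       (a' \<in> S1 k phi \<and> a k > g2 k phi a' \<longrightarrow>
          upper_tail_rate k phi a (a k - g2 k phi a' + \<epsilon>) < 0 \<and>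
          Limsup (at_right 0) (\<lambda>\<delta>. limsup (\<lambda>n.
            ereal (lower_prob k phi a (a k - g2 k phi a' + \<epsilon>) \<delta> n))) = 1))"
proof -
  interpret constraint_functions k phi
  proof
    have "1 \<in> {1..k}" using k by auto
    from C2[rule_format, OF this, of 1]
    show "(\<integral>\<^sup>+x. ennreal (exp (- phi 1 x)) \<partial>pos_lborel) < \<infinity>" by simp
  qed (use k phi_pos C1 C3 in auto)
  define a' where "a' = restrict a {1..k-1}"
  have A: "upper_tail_rate k phi a \<epsilon> < 0 \<and>
      (\<exists>L. (\<forall>\<^sub>F \<delta> in at_right 0. lower_prob k phi a \<epsilon> \<delta> \<longlonglongrightarrow> L \<delta>) \<and> (L \<longlongrightarrow> 1) (at_right 0))"
    if "a' \<in> S2 k phi \<or> (a' \<in> S1 k phi \<and> a k \<le> g2 k phi a')"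
  proof -
    have no: "\<not> (restrict a {1..k-1} \<in> S1 k phi \<and> g2 k phi (restrict a {1..k-1}) \<le> a k - \<epsilon>)"
      using that eps by (auto simp: S2_def a'_def)
    note T = tail_conclusions[OF a g1_cont eps no]
    show ?thesis using T by (intro conjI exI[of _ "\<lambda>_. 1"] tendsto_const)
  qed
  have B: "upper_tail_rate k phi a (a k - g2 k phi a' + \<epsilon>) < 0 \<and>
      Limsup (at_right 0) (\<lambda>\<delta>. limsup (\<lambda>n.
            ereal (lower_prob k phi a (a k - g2 k phi a' + \<epsilon>) \<delta> n))) = 1"
    if "a' \<in> S1 k phi \<and> a k > g2 k phi a'"
  proof -
    define t where "t = a k - g2 k phi a' + \<epsilon>"
    have t: "t > 0" using that eps by (simp add: t_def)
    have no: "\<not> (restrict a {1..k-1} \<in> S1 k phi \<and> g2 k phi (restrict a {1..k-1}) \<le> a k - t)"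
      using eps by (auto simp: t_def a'_def)
    note T = tail_conclusions[OF a g1_cont t no]
    have "\<forall>\<^sub>F \<delta> in at_right 0. limsup (\<lambda>n. ereal (lower_prob k phi a t \<delta> n)) = 1"
      using T(2)
    proof eventually_elim
      case (elim \<delta>)
      hence "(\<lambda>n. ereal (lower_prob k phi a t \<delta> n)) \<longlonglongrightarrow> ereal 1" by simp
      hence "limsup (\<lambda>n. ereal (lower_prob k phi a t \<delta> n)) = ereal 1"
        by (intro lim_imp_Limsup) auto
      thus ?case by simp
    qed
    hence "Limsup (at_right 0) (\<lambda>\<delta>. limsup (\<lambda>n. ereal (lower_prob k phi a t \<delta> n)))
        = Limsup (at_right (0::real)) (\<lambda>_. 1)"
      by (rule Limsup_eq)
    also have "\<dots> = 1" by (intro Limsup_const trivial_limit_at_right_real)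
    finally show ?thesis using T(1) unfolding t_def by blast
  qed
  show ?thesis
    unfolding Let_def using A B unfolding a'_def by blast
qed

end
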